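(* Let $f\ge 1$ be a constant integer. There exists a polynomial-time algorithm that, for every $n$-vertex unweighted undirected graph $G=(V,E)$ and source $s\in V$, constructs (1) an $f$-edge $(3(f+1),\,(f+1)\log n)$ FT-ABFS structure with respect to $s$ with $O(fn)$ edges, and (2) for every integer $k\ge 3$, an $f$-edge $(3(f+1)+1,\,0)$ FT-ABFS structure with respect to $s$ with $O\!\left(fn+n^{1+1/k}+n\cdot((f+1)(2k-1))^{f+1}\right)$ edges.
   Context: For a graph $G'$ and vertices $u,v$, $\mathrm{dist}(u,v,G')$ denotes the number of edges on a shortest $u$–$v$ path in $G'$. For a set $F$ of edges, $G\setminus F$ is the graph obtained by deleting the edges of $F$. Given an unweighted undirected graph $G=(V,E)$ and source $s\in V$, a spanning subgraph $H\subseteq G$ is an $f$-edge $(\alpha,\beta)$ FT-ABFS structure with respect to $s$ if for every $v\in V$ and every $F\subseteq E$ with $|F|\le f$, $\mathrm{dist}(s,v,H\setminus F)\le \alpha\cdot\mathrm{dist}(s,v,G\setminus F)+\beta$. *)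

theory Defs
  imports Complex_Main "HOL-Library.Extended_Real" "HOL-Computational_Algebra.Polynomial"
begin

section \<open>Graphs, distances and fault-tolerant approximate BFS structures\<close>

text \<open>Graphs are simple and undirected; an edge is a two-element set of vertices. A spanning
  subgraph has the same vertex set, so it is given by its edge set alone, and deleting a set
  \<open>F\<close> of edges from a graph with edge set \<open>E\<close> yields the edge set \<open>E - F\<close>.\<close>

definition simple_graph :: "'a set \<Rightarrow> 'a set set \<Rightarrow> bool" where
  "simple_graph V E \<longleftrightarrow> finite V \<and> (\<forall>e\<in>E. e \<subseteq> V \<and> card e = 2)"

definition is_path :: "'a set \<Rightarrow> 'a set set \<Rightarrow> 'a \<Rightarrow> 'a list \<Rightarrow> 'a \<Rightarrow> bool" where
  "is_path V E u p v \<longleftrightarrow>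
     p \<noteq> [] \<and> hd p = u \<and> last p = v \<and> set p \<subseteq> V \<and> distinct p \<and>
     (\<forall>i. Suc i < length p \<longrightarrow> {p ! i, p ! Suc i} \<in> E)"

text \<open>If there is no path from \<open>u\<close> to \<open>v\<close>, this is the infimum of the empty set, i.e. \<open>\<infinity>\<close>.\<close>

definition gdist :: "'a set \<Rightarrow> 'a set set \<Rightarrow> 'a \<Rightarrow> 'a \<Rightarrow> enat" where
  "gdist V E u v = Inf {enat (length p - 1) | p. is_path V E u p v}"

definition ft_abfs ::
    "nat \<Rightarrow> real \<Rightarrow> real \<Rightarrow> 'a set \<Rightarrow> 'a set set \<Rightarrow> 'a \<Rightarrow> 'a set set \<Rightarrow> bool" where
  "ft_abfs f \<alpha> \<beta> V E s H \<longleftrightarrow>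
     H \<subseteq> E \<and>
     (\<forall>v\<in>V. \<forall>F. F \<subseteq> E \<and> card F \<le> f \<longrightarrow>
        ereal_of_enat (gdist V (H - F) s v)
          \<le> ereal \<alpha> * ereal_of_enat (gdist V (E - F) s v) + ereal \<beta>)"


section \<open>Model of computation\<close>

text \<open>A random access machine over the natural numbers, in structured form. The memory consists
  of named scalars and named two-dimensional arrays. One step is charged for each assignment
  and each test. Expressions are built from addition, truncated subtraction and array look-up
  only. Since there is no multiplication, for a fixed program the bit length of the largest number
  in memory grows by at most a constant per step; hence the number of steps is polynomially related
  to Turing machine time.\<close>

type_synonym vname = string

record state =
  scal :: "vname \<Rightarrow> nat"
  arr :: "vname \<Rightarrow> nat \<Rightarrow> nat \<Rightarrow> nat"

datatype aexp =
    Num nat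
  | Var vname
  | Cell vname aexp aexp
  | Plus aexp aexp
  | Minus aexp aexp

fun aval :: "aexp \<Rightarrow> state \<Rightarrow> nat" where
  "aval (Num m) \<sigma> = m"
| "aval (Var x) \<sigma> = scal \<sigma> x"
| "aval (Cell a i j) \<sigma> = arr \<sigma> a (aval i \<sigma>) (aval j \<sigma>)"
| "aval (Plus e1 e2) \<sigma> = aval e1 \<sigma> + aval e2 \<sigma>"
| "aval (Minus e1 e2) \<sigma> = aval e1 \<sigma> - aval e2 \<sigma>"

definition set_scal :: "vname \<Rightarrow> nat \<Rightarrow> state \<Rightarrow> state" where
  "set_scal x m \<sigma> = \<sigma>\<lparr>scal := (scal \<sigma>)(x := m)\<rparr>"

definition set_cell :: "vname \<Rightarrow> nat \<Rightarrow> nat \<Rightarrow> nat \<Rightarrow> state \<Rightarrow> state" where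
  "set_cell a i j m \<sigma> = \<sigma>\<lparr>arr := (arr \<sigma>)(a := (arr \<sigma> a)(i := (arr \<sigma> a i)(j := m)))\<rparr>"

text \<open>In \<open>Cond\<close> and \<open>While\<close> a nonzero value counts as true. \<open>Store a i j e\<close> writes \<open>e\<close>
  to the cell \<open>(i, j)\<close> of the array \<open>a\<close>.\<close>

datatype com =
    Skip
  | Assign vname aexp
  | Store vname aexp aexp aexp
  | Seq com com
  | Cond aexp com com
  | While aexp com

text \<open>\<open>exec c \<sigma> t \<sigma>'\<close>: started in \<open>\<sigma>\<close>, the program \<open>c\<close> terminates in \<open>\<sigma>'\<close> after \<open>t\<close> steps.\<close>

inductive exec :: "com \<Rightarrow> state \<Rightarrow> nat \<Rightarrow> state \<Rightarrow> bool" where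
  Skip: "exec Skip \<sigma> 1 \<sigma>"
| Assign: "exec (Assign x e) \<sigma> 1 (set_scal x (aval e \<sigma>) \<sigma>)"
| Store: "exec (Store a i j e) \<sigma> 1 (set_cell a (aval i \<sigma>) (aval j \<sigma>) (aval e \<sigma>) \<sigma>)"
| Seq: "exec c1 \<sigma> t1 \<sigma>1 \<Longrightarrow> exec c2 \<sigma>1 t2 \<sigma>2 \<Longrightarrow> exec (Seq c1 c2) \<sigma> (t1 + t2) \<sigma>2"
| CondTrue: "aval b \<sigma> \<noteq> 0 \<Longrightarrow> exec c1 \<sigma> t \<sigma>' \<Longrightarrow> exec (Cond b c1 c2) \<sigma> (Suc t) \<sigma>'"
| CondFalse: "aval b \<sigma> = 0 \<Longrightarrow> exec c2 \<sigma> t \<sigma>' \<Longrightarrow> exec (Cond b c1 c2) \<sigma> (Suc t) \<sigma>'"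
| WhileFalse: "aval b \<sigma> = 0 \<Longrightarrow> exec (While b c) \<sigma> 1 \<sigma>"
| WhileTrue: "aval b \<sigma> \<noteq> 0 \<Longrightarrow> exec c \<sigma> t1 \<sigma>1 \<Longrightarrow> exec (While b c) \<sigma>1 t2 \<sigma>2 \<Longrightarrow>
    exec (While b c) \<sigma> (Suc (t1 + t2)) \<sigma>2"


section \<open>Input and output\<close>

definition adj_matrix :: "nat set set \<Rightarrow> nat \<Rightarrow> nat \<Rightarrow> nat" where
  "adj_matrix E u v = (if {u, v} \<in> E then 1 else 0)"

text \<open>The input graph has the vertex set \<open>{..<n}\<close>. The value \<open>k = 0\<close> means that no stretch
  parameter is supplied. All other memory is initially zero.\<close>

definition input :: "nat \<Rightarrow> nat set set \<Rightarrow> nat \<Rightarrow> nat \<Rightarrow> state" where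
  "input n E s k =
     \<lparr>scal = (\<lambda>_. 0)(''n'' := n, ''s'' := s, ''k'' := k),
      arr = (\<lambda>_ _ _. 0)(''G'' := adj_matrix E)\<rparr>"

definition constructs_within :: "com \<Rightarrow> state \<Rightarrow> nat \<Rightarrow> nat set set \<Rightarrow> bool" where
  "constructs_within A \<sigma> T H \<longleftrightarrow>
     (\<exists>t \<sigma>'. exec A \<sigma> t \<sigma>' \<and> t \<le> T \<and> arr \<sigma>' ''H'' = adj_matrix H)"

end

theory Submission
  imports Defs
begin

text \<open>Let \<open>t = 2 \<kappa> - 1\<close>. The structure is the union of a BFS tree of \<open>G\<close> and of \<open>f + 1\<close> edge-disjoint greedy
  \<open>t\<close>-spanners, each one taken in what the previous ones left over; each has girth above \<open>2 \<kappa>\<close>, hence at most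
  \<open>n^(1 + 1/\<kappa>)\<close> edges. A surviving edge of \<open>G\<close> outside the union is bypassed in all spanners, so
  \<open>f\<close> faults leave one bypass of length \<open>t\<close> intact. The faults cut the tree into at most \<open>f + 1\<close>
  parts; a shortest path of length \<open>d\<close> in \<open>G \<setminus> F\<close> is followed by jumping inside each part along the tree,
  at cost \<open>2 d\<close>, and by crossing at most \<open>f\<close> times between parts, at cost \<open>t\<close>. The total
  is \<open>2 (f + 1) d + f t\<close>.

  Part (1) takes \<open>4\<^sup>\<kappa> \<ge> n\<close> with \<open>\<kappa>\<close> minimal, so that \<open>t \<le> log n + 1\<close>. Part (2) takes \<open>\<kappa> = 2 k\<close>, which is good
  enough once \<open>d \<ge> t\<close>. For \<open>d \<le> R = (f + 1)(2 k - 1)\<close> distances are preserved exactly: for each \<open>d\<close> in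
  increasing order, each \<open>F\<close> and each \<open>v\<close> at distance \<open>d\<close> from \<open>s\<close> in \<open>G \<setminus> F\<close>, the last edge of a shortest path is added
  unless some such edge is already there. If the \<open>i\<close>-th edge added at \<open>v\<close> comes with path \<open>P\<^sub>i\<close> and
  fault set \<open>F\<^sub>i\<close>, then \<open>P\<^sub>i\<close> avoids \<open>F\<^sub>i\<close> but meets all later \<open>F\<^sub>j\<close>, which bounds the number of edges added
  at \<open>v\<close> by \<open>1 + R + \<dots> + R\<^sup>f\<close>.\<close>

subsection \<open>Walks of bounded length\<close>

text \<open>Walks of at most \<open>l\<close> edges instead of simple paths: they are monotone in
  length and edge set, and concatenating two of them needs no removal of repeated vertices.\<close>

primrec reach :: "'a set set \<Rightarrow> nat \<Rightarrow> 'a \<Rightarrow> 'a \<Rightarrow> bool" where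
  "reach E 0 u v \<longleftrightarrow> u = v"
| "reach E (Suc l) u v \<longleftrightarrow> reach E l u v \<or> (\<exists>w. reach E l u w \<and> {w, v} \<in> E)"

lemma reach_refl [simp]: "reach E l u u"
  by (induction l) auto

lemma reach_mono_length: "reach E l u v \<Longrightarrow> l \<le> m \<Longrightarrow> reach E m u v"
  by (induction m) (auto simp: le_Suc_eq)

lemma reach_mono: "reach E l u v \<Longrightarrow> E \<subseteq> E' \<Longrightarrow> reach E' l u v"
  by (induction l arbitrary: v) auto

lemma reach_edge: "{u, v} \<in> E \<Longrightarrow> 1 \<le> l \<Longrightarrow> reach E l u v"
  using reach_mono_length[of E 1 u v l] by auto

lemma reach_trans: "reach E l u v \<Longrightarrow> reach E m v w \<Longrightarrow> reach E (l + m) u w"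
  by (induction m arbitrary: w) auto

lemma reach_sym: "reach E l u v \<Longrightarrow> reach E l v u"
proof (induction l arbitrary: v)
  case (Suc l)
  then consider "reach E l u v" | w where "reach E l u w" "{w, v} \<in> E" by auto
  then show ?case
  proof cases
    case 2
    then have "reach E (1 + l) v u"
      using Suc.IH[OF 2(1)] reach_edge[of v w E 1] by (intro reach_trans[of E 1 v w]) (auto simp: insert_commute)
    then show ?thesis by simp
  qed (use Suc.IH in auto)
qed simp

text \<open>\<open>P\<close> is the edge set of one walk. It is the set that later fault sets are
  forced to meet in the counting of last edges, so its size must be bounded.\<close>

lemma reach_edges:
  "reach E l u v \<Longrightarrow> \<exists>P\<subseteq>E. finite P \<and> card P \<le> l \<and> reach P l u v"
proof (induction l arbitrary: v)
  case (Suc l)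
  then consider "reach E l u v" | w where "reach E l u w" "{w, v} \<in> E" by auto
  then show ?case
  proof cases
    case 1
    then show ?thesis using Suc.IH[OF 1] by (metis le_SucI reach.simps(2))
  next
    case 2
    from Suc.IH[OF 2(1)] obtain P where P: "P \<subseteq> E" "finite P" "card P \<le> l" "reach P l u w" by auto
    have "reach (insert {w, v} P) (Suc l) u v"
      using reach_mono[OF P(4), of "insert {w, v} P"] by auto
    moreover have "card (insert {w, v} P) \<le> Suc l" using P(2,3) by (simp add: card_insert_if)
    ultimately show ?thesis using P 2(2) by (intro exI[of _ "insert {w, v} P"]) auto
  qed
qed (intro exI[of _ "{}"], simp)

lemma reach_in:
  assumes "reach E l u v" "u \<in> V" "\<And>e. e \<in> E \<Longrightarrow> e \<subseteq> V"
  shows "v \<in> V"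
  using assms(1) by (induction l arbitrary: v) (use assms(2,3) in auto)

section \<open>Walks versus the simple paths behind \<open>gdist\<close>\<close>

lemma is_path_imp_reach:
  "is_path V E u p v \<Longrightarrow> reach E (length p - 1) u v"
proof (induction p arbitrary: v rule: rev_induct)
  case (snoc y p)
  show ?case
  proof (cases "p = []")
    case False
    have "is_path V E u p (last p)"
      unfolding is_path_def
    proof (intro conjI allI impI)
      fix i assume i: "Suc i < length p"
      then have "{(p @ [y]) ! i, (p @ [y]) ! Suc i} \<in> E"
        using snoc.prems unfolding is_path_def by (metis length_append_singleton less_Suc_eq)
      then show "{p ! i, p ! Suc i} \<in> E" using i by (simp add: nth_append)
    qed (use snoc.prems False in \<open>auto simp: is_path_def\<close>)
    then have "reach E (length p - 1) u (last p)" by (rule snoc.IH)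
    moreover have "{(p @ [y]) ! (length p - 1), (p @ [y]) ! Suc (length p - 1)} \<in> E"
      using snoc.prems False unfolding is_path_def by (metis One_nat_def Suc_pred length_append_singleton length_greater_0_conv lessI)
    then have "{last p, y} \<in> E" using False by (simp add: nth_append last_conv_nth)
    moreover have "y = v" using snoc.prems by (simp add: is_path_def)
    ultimately have "reach E (Suc (length p - 1)) u v" by auto
    then show ?thesis using False by simp
  qed (use snoc.prems in \<open>auto simp: is_path_def\<close>)
qed (simp add: is_path_def)

lemma reach_imp_is_path:
  assumes "reach E l u v" "u \<in> V" "\<And>e. e \<in> E \<Longrightarrow> e \<subseteq> V"
  shows "\<exists>p. is_path V E u p v \<and> length p - 1 \<le> l"
  using assms(1)
proof (induction l arbitrary: v)
  case 0
  then show ?case using assms(2) by (intro exI[of _ "[u]"]) (auto simp: is_path_def)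
next
  case (Suc l)
  then consider "reach E l u v" | w where "reach E l u w" "{w, v} \<in> E" by auto
  then show ?case
  proof cases
    case 1
    then show ?thesis using Suc.IH le_SucI by blast
  next
    case 2
    from Suc.IH[OF 2(1)] obtain p where p: "is_path V E u p w" "length p - 1 \<le> l" by auto
    show ?thesis
    proof (cases "v \<in> set p")
      case True
      then obtain i where i: "i < length p" "p ! i = v" by (auto simp: in_set_conv_nth)
      \<comment> \<open>The target already lies on \<open>p\<close>; cutting \<open>p\<close> there
        keeps the vertices distinct.\<close>
      have "is_path V E u (take (Suc i) p) v"
        unfolding is_path_def
      proof (intro conjI allI impI)
        show "take (Suc i) p \<noteq> []" "hd (take (Suc i) p) = u" "distinct (take (Suc i) p)"
          using p(1) i by (auto simp: is_path_def)
        show "last (take (Suc i) p) = v" using i by (simp add: take_Suc_conv_app_nth)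
        show "set (take (Suc i) p) \<subseteq> V" using p(1) by (auto simp: is_path_def dest: in_set_takeD)
        show "{take (Suc i) p ! j, take (Suc i) p ! Suc j} \<in> E" if "Suc j < length (take (Suc i) p)" for j
          using p(1) that by (auto simp: is_path_def)
      qed
      then show ?thesis using p(2) i by (intro exI[of _ "take (Suc i) p"]) auto
    next
      case False
      have "is_path V E u (p @ [v]) v"
        unfolding is_path_def
      proof (intro conjI allI impI)
        fix i assume i: "Suc i < length (p @ [v])"
        show "{(p @ [v]) ! i, (p @ [v]) ! Suc i} \<in> E"
        proof (cases "Suc i < length p")
          case True
          then show ?thesis using p(1) unfolding is_path_def by (auto simp: nth_append)
        next
          case False
          then have "i = length p - 1" "p \<noteq> []" using i p(1) by (auto simp: is_path_def)
          then show ?thesis using 2(2) p(1)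
            by (auto simp: nth_append is_path_def last_conv_nth)
        qed
      qed (use p(1) False 2(2) assms(3) in \<open>auto simp: is_path_def\<close>)
      moreover have "p \<noteq> []" using p(1) by (simp add: is_path_def)
      ultimately show ?thesis using p(2)
        by (intro exI[of _ "p @ [v]"]) (cases p, auto)
    qed
  qed
qed

lemma gdist_le_iff:
  assumes "u \<in> V" "\<And>e. e \<in> E \<Longrightarrow> e \<subseteq> V"
  shows "gdist V E u v \<le> enat l \<longleftrightarrow> reach E l u v"
proof
  assume "gdist V E u v \<le> enat l"
  \<comment> \<open>A strict bound on an infimum yields an actual path below it.\<close>
  then have "gdist V E u v < enat (Suc l)" by (metis enat_ord_simps(2) lessI order_le_less_trans)
  then obtain p where "is_path V E u p v" "length p - 1 \<le> l"
    unfolding gdist_def Inf_less_iff by auto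
  then show "reach E l u v" by (meson is_path_imp_reach reach_mono_length)
next
  assume "reach E l u v"
  then obtain p where p: "is_path V E u p v" "length p - 1 \<le> l"
    using reach_imp_is_path assms by metis
  then have "gdist V E u v \<le> enat (length p - 1)" unfolding gdist_def by (auto intro: Inf_lower)
  then show "gdist V E u v \<le> enat l" using p(2) by (meson enat_ord_simps(1) order_trans)
qed

text \<open>Reachability saturates at length \<open>card V\<close>. This is why tables with rows up
  to \<open>n\<close> and parameters truncated to \<open>n\<close> lose nothing.\<close>

lemma reach_card:
  assumes "reach E l u v" "finite V" "u \<in> V" "\<And>e. e \<in> E \<Longrightarrow> e \<subseteq> V"
  shows "reach E (card V) u v"
proof -
  obtain p where p: "is_path V E u p v" using reach_imp_is_path assms by metis
  then have "length p \<le> card V"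
    using assms(2) unfolding is_path_def by (metis card_mono distinct_card)
  then show ?thesis using is_path_imp_reach[OF p] by (auto intro: reach_mono_length)
qed

subsection \<open>Greedy spanners\<close>

text \<open>An edge and a bypass of at most \<open>t\<close> edges would close a cycle of length at
  most \<open>t + 1\<close>; so this says that all cycles are longer than that. A singleton in
  \<open>S\<close> is excluded as well, since \<open>reach\<close> is reflexive.\<close>

definition girth_above :: "nat \<Rightarrow> 'a set set \<Rightarrow> bool" where
  "girth_above t S \<longleftrightarrow> (\<forall>x y. {x, y} \<in> S \<longrightarrow> \<not> reach (S - {{x, y}}) t x y)"

text \<open>A walk that crosses \<open>uv\<close> repeatedly can be shortcut so that it crosses at
  most once; \<open>a\<close> and \<open>b\<close> are the lengths before and after that
  crossing.\<close>

lemma reach_insert: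
  "reach (insert {u, v} A) t x y \<Longrightarrow> reach A t x y \<or>
     (\<exists>a b. a + b + 1 \<le> t \<and> (reach A a x u \<and> reach A b v y \<or> reach A a x v \<and> reach A b u y))"
proof (induction t arbitrary: y)
  case (Suc t)
  then consider "reach (insert {u, v} A) t x y"
    | w where "reach (insert {u, v} A) t x w" "{w, y} \<in> insert {u, v} A" by auto
  then show ?case
  proof cases
    case 1
    then show ?thesis using Suc.IH[OF 1] by (metis le_SucI reach.simps(2))
  next
    case 2
    show ?thesis
    proof (cases "{w, y} \<in> A")
      case True
      from Suc.IH[OF 2(1)] show ?thesis
      proof (elim disjE exE conjE)
        assume "reach A t x w" then show ?thesis using True by auto
      next
        fix a b assume "a + b + 1 \<le> t" "reach A a x u" "reach A b v w"
        then show ?thesis using True by (intro disjI2 exI[of _ a] exI[of _ "Suc b"]) auto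
      next
        fix a b assume "a + b + 1 \<le> t" "reach A a x v" "reach A b u w"
        then show ?thesis using True by (intro disjI2 exI[of _ a] exI[of _ "Suc b"]) auto
      qed
    next
      case False
      then have uv: "w = u \<and> y = v \<or> w = v \<and> y = u" using 2(2) by (auto simp: doubleton_eq_iff)
      \<comment> \<open>The last step is \<open>uv\<close> itself. If \<open>uv\<close> was crossed
        before, the part before that crossing stays in \<open>A\<close> and ends at \<open>w\<close>
        or already at \<open>y\<close>.\<close>
      have "reach A t x w \<or> (\<exists>a\<le>t. reach A a x u) \<and> w = v \<or> (\<exists>a\<le>t. reach A a x v) \<and> w = u
        \<or> (\<exists>a\<le>t. reach A a x w)"
        using Suc.IH[OF 2(1)] uv
      proof (elim disjE exE conjE)
        fix a b assume "a + b + 1 \<le> t" "reach A a x u"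
        then have "\<exists>a\<le>t. reach A a x u" by (intro exI[of _ a]) auto
        then show ?thesis using uv by auto
      next
        fix a b assume "a + b + 1 \<le> t" "reach A a x v"
        then have "\<exists>a\<le>t. reach A a x v" by (intro exI[of _ a]) auto
        then show ?thesis using uv by auto
      qed auto
      then have "reach A t x w \<or> reach A t x y" using uv by (auto intro: reach_mono_length)
      then show ?thesis using uv
        by (metis Suc_eq_plus1 add.right_neutral le_refl reach.simps reach_refl)
    qed
  qed
qed simp

text \<open>A short bypass of an old edge \<open>xy\<close> must cross the new edge
  \<open>uv\<close>. Going round the same cycle the other way, through \<open>xy\<close>, then
  bypasses \<open>uv\<close> inside \<open>S\<close> with at most \<open>t\<close> edges, contrary
  to \<open>uv(1)\<close>.\<close>

lemma girth_above_insert: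
  assumes g: "girth_above t S" and uv: "\<not> reach S t u v" "{u, v} \<notin> S"
  shows "girth_above t (insert {u, v} S)"
  unfolding girth_above_def
proof (intro allI impI notI)
  fix x y assume xy: "{x, y} \<in> insert {u, v} S" and r: "reach (insert {u, v} S - {{x, y}}) t x y"
  show False
  proof (cases "{x, y} = {u, v}")
    case True
    then have "reach S t x y" using r uv(2) by auto
    then show False using True uv(1) reach_sym[of S t x y] by (auto simp: doubleton_eq_iff)
  next
    case False
    then have S: "{x, y} \<in> S" and "insert {u, v} S - {{x, y}} = insert {u, v} (S - {{x, y}})"
      using xy by auto
    then have "reach (insert {u, v} (S - {{x, y}})) t x y" using r by simp
    then have "\<exists>a b. a + b + 1 \<le> t \<and> (reach S a x u \<and> reach S b v y \<or> reach S a x v \<and> reach S b u y)"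
      using reach_insert[of u v "S - {{x, y}}" t x y] g S unfolding girth_above_def
      by (meson Diff_subset reach_mono)
    then obtain a b where ab: "a + b + 1 \<le> t"
      "reach S a x u \<and> reach S b v y \<or> reach S a x v \<and> reach S b u y" by blast
    have e: "reach S 1 x y" "reach S 1 y x" using S by (auto simp: insert_commute)
    from ab(2) have "reach S (a + 1 + b) u v"
    proof
      assume "reach S a x u \<and> reach S b v y"
      then show ?thesis using e by (meson reach_sym reach_trans)
    next
      assume "reach S a x v \<and> reach S b u y"
      then have "reach S (b + 1 + a) u v" using e by (meson reach_trans)
      then show ?thesis by (simp add: ac_simps)
    qed
    then show False using uv(1) ab(1) reach_mono_length[of S "a + 1 + b" u v t] by simp
  qed
qed

text \<open>Every vertex before the end of the walk is within distance less than \<open>l\<close> of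
  \<open>u\<close>, so it is not \<open>y\<close>; the end is not \<open>y\<close> either. Hence no
  edge at \<open>y\<close> is used.\<close>

lemma reach_avoiding_farther:
  assumes "reach E l u x" "x \<noteq> y" "\<And>l'. l' < l \<Longrightarrow> \<not> reach E l' u y"
  shows "reach (E - {{z, y}}) l u x"
  using assms
proof (induction l arbitrary: x)
  case (Suc l)
  then consider "reach E l u x" | w where "reach E l u w" "{w, x} \<in> E" by auto
  then show ?case
  proof cases
    case 1
    then show ?thesis using Suc by (metis less_SucI reach.simps(2))
  next
    case 2
    have "w \<noteq> y" using 2(1) Suc.prems(3) by blast
    then have "reach (E - {{z, y}}) l u w" using Suc.IH[OF 2(1)] Suc.prems(3) by simp
    moreover have "{w, x} \<noteq> {z, y}" using \<open>w \<noteq> y\<close> Suc.prems(2) by auto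
    ultimately show ?thesis using 2(2) by auto
  qed
qed simp

text \<open>Two neighbours of \<open>y\<close> that are no farther from \<open>u\<close> than \<open>y\<close> close a short cycle, so mapping
  an edge to its farther endpoint is injective.\<close>

lemma girth_ball_edges:
  assumes g: "girth_above (2 * k - 1) S" and i: "i < k" and E: "E \<subseteq> S"
    and V: "finite V" "u \<in> V" "\<And>e. e \<in> E \<Longrightarrow> e \<subseteq> V \<and> card e = 2"
  shows "card {e \<in> E. \<exists>x\<in>e. reach E i u x} \<le> card {x. reach E (Suc i) u x}"
proof -
  define lev where "lev x = (LEAST l. reach E l u x)" for x
  define Es where "Es = {e \<in> E. \<exists>x\<in>e. reach E i u x}"
  have lev: "reach E (lev x) u x" "lev x \<le> l" if "reach E l u x" for l x
    using that unfolding lev_def by (fact LeastI, fact Least_le)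
  have fin: "finite {x. reach E (Suc i) u x}"
    using V reach_in[of E "Suc i" u _ V] by (intro finite_subset[OF _ V(1)]) blast
  have "\<forall>e\<in>Es. \<exists>y x. e = {x, y} \<and> x \<noteq> y \<and> lev x \<le> lev y \<and> reach E i u x \<and> reach E (Suc i) u y"
  proof
    fix e assume e: "e \<in> Es"
    then obtain x where x: "x \<in> e" "reach E i u x" "e \<in> E" unfolding Es_def by auto
    then obtain y where y: "e = {x, y}" "x \<noteq> y" using V(3)[OF x(3)] by (auto simp: card_2_iff)
    then have ry: "reach E (Suc i) u y" using x by auto
    show "\<exists>y x. e = {x, y} \<and> x \<noteq> y \<and> lev x \<le> lev y \<and> reach E i u x \<and> reach E (Suc i) u y"
    proof (cases "lev x \<le> lev y")
      case True
      then show ?thesis using x y ry by blast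
    next
      case False
      then have "lev y \<le> i" using lev(2)[OF x(2)] by simp
      then have "reach E i u y" using lev(1)[OF ry] by (rule reach_mono_length[rotated])
      moreover have "e = {y, x}" "reach E (Suc i) u x" "lev y \<le> lev x" using x y False by auto
      ultimately show ?thesis using y(2) by blast
    qed
  qed
  from bchoice[OF this] obtain fr where fr: "\<forall>e\<in>Es. \<exists>x. e = {x, fr e} \<and> x \<noteq> fr e \<and> lev x \<le> lev (fr e)
      \<and> reach E i u x \<and> reach E (Suc i) u (fr e)" ..
  have "inj_on fr Es"
  proof (rule inj_onI, rule ccontr)
    fix e e' assume e: "e \<in> Es" "e' \<in> Es" "fr e = fr e'" "e \<noteq> e'"
    define y where "y = fr e"
    from bspec[OF fr e(1)] obtain x where x: "e = {x, y}" "x \<noteq> y" "lev x \<le> lev y" "reach E i u x"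
      unfolding y_def by (elim exE conjE)
    from bspec[OF fr e(2)] obtain x' where x': "e' = {x', y}" "x' \<noteq> y" "lev x' \<le> lev y" "reach E i u x'"
      unfolding y_def e(3) by (elim exE conjE)
    note ex = x(1) x'(1) x(2) x'(2) x(3) x'(3) x(4) x'(4)
    have far: "\<not> reach E l' u y" if "lev z \<le> lev y" "l' < lev z" for l' z
      using that lev(2)[of l' y] by linarith
    have "reach (E - {{x, y}}) (lev x) u x" "reach (E - {{x, y}}) (lev x') u x'"
      using reach_avoiding_farther[OF lev(1)[OF ex(7)] ex(3) far[OF ex(5)]]
        reach_avoiding_farther[OF lev(1)[OF ex(8)] ex(4) far[OF ex(6)]] by blast+
    moreover have "lev x \<le> i" "lev x' \<le> i" using lev(2) ex by auto
    ultimately have "reach (E - {{x, y}}) i x u" "reach (E - {{x, y}}) i u x'"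
      using reach_mono_length[of _ "lev x" u x i] reach_mono_length[of _ "lev x'" u x' i] reach_sym
      by metis+
    moreover have "{x', y} \<in> E - {{x, y}}" using e ex unfolding Es_def by auto
    then have "reach (E - {{x, y}}) 1 x' y" by auto
    \<comment> \<open>From \<open>x\<close> to the centre \<open>u\<close>, on to \<open>x'\<close>,
      then along \<open>{x', y}\<close>. As \<open>i < k\<close>, this has at most
      \<open>2 * k - 1\<close> edges.\<close>
    ultimately have "reach (E - {{x, y}}) (i + i + 1) x y" by (meson reach_trans)
    then have "reach (S - {{x, y}}) (2 * k - 1) x y"
      using i E reach_mono_length[of "E - {{x, y}}" "i + i + 1" x y "2 * k - 1"]
        reach_mono[of "E - {{x, y}}" "2 * k - 1" x y "S - {{x, y}}"] by auto
    moreover have "{x, y} \<in> S" using e(1) ex E unfolding Es_def by auto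
    ultimately show False using g unfolding girth_above_def by blast
  qed
  moreover have "fr ` Es \<subseteq> {x. reach E (Suc i) u x}" using fr by auto
  ultimately have "card Es \<le> card {x. reach E (Suc i) u x}" using card_inj_on_le fin by metis
  then show ?thesis unfolding Es_def .
qed

text \<open>Ball growing: around \<open>u\<close>, the balls of radius up to \<open>k\<close> cannot
  all grow by a factor above \<delta>, since \<open>\<delta> ^ k\<close> is at least the number of
  vertices. At a radius \<open>i\<close> where growth fails, removing the ball \<open>B i\<close>
  destroys at most \<open>card (B (Suc i))\<close>, hence at most
  \<open>\<delta> * card (B i)\<close>, edges; the rest is handled by induction on \<open>W\<close>.
  The intended \<delta> is the \<open>k\<close>-th root of the number of vertices.\<close>

lemma girth_edge_bound:
  fixes \<delta> :: real
  assumes g: "girth_above (2 * k - 1) S" and k: "k \<ge> 1"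
    and V: "finite V" "\<And>e. e \<in> S \<Longrightarrow> e \<subseteq> V \<and> card e = 2"
    and \<delta>: "\<delta> \<ge> 0" "\<delta> ^ k \<ge> real (card V)"
  shows "W \<subseteq> V \<Longrightarrow> real (card {e \<in> S. e \<subseteq> W}) \<le> \<delta> * real (card W)"
proof (induction "card W" arbitrary: W rule: less_induct)
  case less
  have finW: "finite W" using less.prems V(1) finite_subset by blast
  show ?case
  proof (cases "W = {}")
    case True
    then have "{e \<in> S. e \<subseteq> W} = {}" using V(2) by fastforce
    then show ?thesis using True by simp
  next
    case False
    then obtain u where u: "u \<in> W" by blast
    define E where "E = {e \<in> S. e \<subseteq> W}"
    define B where "B i = {x. reach E i u x}" for i
    have BW: "B i \<subseteq> W" for i
      using reach_in[of E i u _ W] u unfolding B_def E_def by blast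
    then have finB: "finite (B i)" for i using finW finite_subset by blast
    have "\<exists>i<k. real (card (B (Suc i))) \<le> \<delta> * real (card (B i))"
    proof (rule ccontr)
      assume "\<not> ?thesis"
      then have grow: "real (card (B (Suc i))) > \<delta> * real (card (B i))" if "i < k" for i
        using that by force
      \<comment> \<open>Strictness for \<open>i > 0\<close> gives the contradiction at
        \<open>i = k\<close> also when \<open>\<delta> ^ k\<close> equals
        \<open>card V\<close>.\<close>
      have "real (card (B i)) \<ge> \<delta> ^ i \<and> (i > 0 \<longrightarrow> real (card (B i)) > \<delta> ^ i)" if "i \<le> k" for i
        using that
      proof (induction i)
        case 0
        have "B 0 = {u}" unfolding B_def by auto
        then show ?case by simp
      next
        case (Suc i)
        have "\<delta> ^ Suc i \<le> \<delta> * real (card (B i))" using Suc \<delta>(1) by (auto intro: mult_left_mono)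
        then show ?case using grow[of i] Suc.prems by auto
      qed
      from this[of k] k have "real (card (B k)) > real (card V)" using \<delta>(2) by auto
      moreover have "card (B k) \<le> card V" using BW less.prems V(1) by (meson card_mono order_trans)
      ultimately show False by simp
    qed
    then obtain i where i: "i < k" "real (card (B (Suc i))) \<le> \<delta> * real (card (B i))" by blast
    have uB: "u \<in> B i" unfolding B_def by simp
    have "card {e \<in> E. \<exists>x\<in>e. reach E i u x} \<le> card {x. reach E (Suc i) u x}"
      by (rule girth_ball_edges[OF g i(1), where V = W]) (use u finW V(2) in \<open>auto simp: E_def\<close>)
    then have 1: "card {e \<in> E. \<exists>x\<in>e. x \<in> B i} \<le> card (B (Suc i))"
      unfolding B_def mem_Collect_eq .
    have "card (W - B i) < card W" using u uB finW by (intro psubset_card_mono) auto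
    then have 2: "real (card {e \<in> S. e \<subseteq> W - B i}) \<le> \<delta> * real (card (W - B i))"
      using less.hyps less.prems by blast
    have "{e \<in> E. \<exists>x\<in>e. x \<in> B i} \<union> {e \<in> S. e \<subseteq> W - B i} = E"
      unfolding E_def by auto
    then have "card E \<le> card {e \<in> E. \<exists>x\<in>e. x \<in> B i} + card {e \<in> S. e \<subseteq> W - B i}"
      using card_Un_le[of "{e \<in> E. \<exists>x\<in>e. x \<in> B i}" "{e \<in> S. e \<subseteq> W - B i}"] by (simp only:)
    then have "real (card E) \<le> \<delta> * real (card (B i)) + \<delta> * real (card (W - B i))"
      using 1 2 i(2) by linarith
    also have "\<dots> = \<delta> * real (card W)"
      using BW finB finW by (simp add: card_Diff_subset card_mono of_nat_diff algebra_simps)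
    finally show ?thesis unfolding E_def .
  qed
qed

subsection \<open>Skew set pairs\<close>

lemma skew_set_pairs:
  fixes P F :: "nat \<Rightarrow> 'b set"
  assumes "finite I" "\<And>i. i \<in> I \<Longrightarrow> finite (P i) \<and> card (P i) \<le> D"
    "\<And>i. i \<in> I \<Longrightarrow> finite (F i) \<and> card (F i) \<le> f" "\<And>i. i \<in> I \<Longrightarrow> P i \<inter> F i = {}"
    "\<And>i j. i \<in> I \<Longrightarrow> j \<in> I \<Longrightarrow> i < j \<Longrightarrow> P i \<inter> F j \<noteq> {}"
  shows "card I \<le> (\<Sum>i\<le>f. D ^ i)"
  using assms
proof (induction f arbitrary: I F)
  case 0
  have "I \<subseteq> {Min I}"
  proof
    fix j assume j: "j \<in> I"
    then have "F j = {}" "Min I \<le> j" using 0(1) 0(3)[of j] by auto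
    moreover have "Min I \<in> I" using 0(1) j by (intro Min_in) auto
    ultimately
    show "j \<in> {Min I}" using 0(5)[of "Min I" j] j by (cases "Min I = j") auto
  qed
  then have "card I \<le> card {Min I}" by (intro card_mono) auto
  then show ?case by simp
next
  case (Suc f)
  show ?case
  proof (cases "I = {}")
    case False
    define m where "m = Min I"
    have m: "m \<in> I" "\<And>j. j \<in> I \<Longrightarrow> m \<le> j" using False Suc.prems(1) unfolding m_def by auto
    define J where "J e = {j \<in> I. e \<in> F j}" for e
    have sub: "I \<subseteq> insert m (\<Union>e\<in>P m. J e)"
    proof
      fix j assume j: "j \<in> I"
      show "j \<in> insert m (\<Union>e\<in>P m. J e)"
      proof (cases "j = m")
        case False
        then have "P m \<inter> F j \<noteq> {}" using Suc.prems(5)[of m j] m j le_neq_implies_less by metis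
        then show ?thesis unfolding J_def using j by auto
      qed simp
    qed
    have J: "card (J e) \<le> (\<Sum>i\<le>f. D ^ i)" for e
    proof (rule Suc.IH[of "J e" "\<lambda>j. F j - {e}"])
      fix i j assume ij: "i \<in> J e" "j \<in> J e" "i < j"
      then have "P i \<inter> F j \<noteq> {}" "e \<notin> P i" using Suc.prems(4,5) unfolding J_def by auto
      then show "P i \<inter> (F j - {e}) \<noteq> {}" by auto
    next
      fix i assume i: "i \<in> J e"
      then show "finite (F i - {e}) \<and> card (F i - {e}) \<le> f"
        using Suc.prems(3)[of i] unfolding J_def by auto
    qed (use Suc.prems in \<open>auto simp: J_def\<close>)
    have finP: "finite (P m)" "card (P m) \<le> D" using Suc.prems(2) m by auto
    have "finite (\<Union>e\<in>P m. J e)" using finP Suc.prems(1) unfolding J_def by auto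
    then have "card I \<le> Suc (card (\<Union>e\<in>P m. J e))"
      using card_mono[OF _ sub] by (simp add: card_insert_if split: if_splits)
    also have "card (\<Union>e\<in>P m. J e) \<le> (\<Sum>e\<in>P m. card (J e))" using finP(1) by (rule card_UN_le)
    also have "\<dots> \<le> (\<Sum>e\<in>P m. \<Sum>i\<le>f. D ^ i)" using J by (intro sum_mono) auto
    also have "\<dots> \<le> D * (\<Sum>i\<le>f. D ^ i)" using finP(2) by simp
    also have "Suc (D * (\<Sum>i\<le>f. D ^ i)) = (\<Sum>i\<le>Suc f. D ^ i)"
      by (subst sum.atMost_Suc_shift) (simp add: sum_distrib_left)
    finally show ?thesis by simp
  qed simp
qed

subsection \<open>Stretch\<close>

text \<open>One BFS layer: vertices at distance exactly \<open>d + 1\<close> keep in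
  \<open>H\<close> the last edge of some shortest path. Over all \<open>d\<close> this makes
  \<open>H\<close> contain a BFS tree. The set \<open>A\<close> records how far a loop over the
  vertices has come.\<close>

definition last_edges :: "'a set set \<Rightarrow> 'a \<Rightarrow> nat \<Rightarrow> 'a set \<Rightarrow> 'a set set \<Rightarrow> bool" where
  "last_edges E s d A H \<longleftrightarrow> (\<forall>v\<in>A. reach E (Suc d) s v \<and> \<not> reach E d s v \<longrightarrow>
     (\<exists>w. reach E d s w \<and> {w, v} \<in> E \<inter> H))"

lemma last_edges_mono: "last_edges E s d A H \<Longrightarrow> H \<subseteq> H' \<Longrightarrow> last_edges E s d A H'"
  unfolding last_edges_def by blast

text \<open>The kept edge lies in \<open>E - F\<close>, so it survives in \<open>H - F\<close>; its
  other end is one layer closer, where the induction applies.\<close>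

lemma reach_last_edges:
  assumes "\<And>d. d < D \<Longrightarrow> last_edges (E - F) s d UNIV H" "reach (E - F) d s v" "d \<le> D"
  shows "reach (H - F) d s v"
  using assms(2,3)
proof (induction d arbitrary: v)
  case (Suc d)
  show ?case
  proof (cases "reach (E - F) d s v")
    case False
    then obtain w where "reach (E - F) d s w" "{w, v} \<in> (E - F) \<inter> H"
      using assms(1)[of d] Suc.prems unfolding last_edges_def by auto
    then show ?thesis using Suc by auto
  qed (use Suc in auto)
qed simp

text \<open>Makes the vertices of the walk visible; their distance bound later limits their depth in
  the BFS tree.\<close>

lemma reach_imp_walk:
  "reach E d s v \<Longrightarrow> \<exists>p. p \<noteq> [] \<and> hd p = s \<and> last p = v \<and>
     successively (\<lambda>x y. {x, y} \<in> E) p \<and> (\<forall>x\<in>set p. reach E d s x)"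
proof (induction d arbitrary: v)
  case 0
  then show ?case by (intro exI[of _ "[s]"]) auto
next
  case (Suc d)
  then consider "reach E d s v" | w where "reach E d s w" "{w, v} \<in> E" by auto
  then show ?case
  proof cases
    case 1
    then show ?thesis using Suc.IH[OF 1] by auto
  next
    case 2
    then obtain p where "p \<noteq> []" "hd p = s" "last p = w"
       "successively (\<lambda>x y. {x, y} \<in> E) p" "\<forall>x\<in>set p. reach E d s x" using Suc.IH by blast
    then show ?thesis using 2 by (intro exI[of _ "p @ [v]"]) (auto simp: successively_append_iff)
  qed
qed

text \<open>Follow the walk, jumping from each vertex to the last one that lies in the same class.\<close>

lemma reach_class_walk:
  assumes same: "\<And>x y. x \<in> X \<Longrightarrow> y \<in> X \<Longrightarrow> rt x = rt y \<Longrightarrow> reach H a x y"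
    and edge: "\<And>x y. {x, y} \<in> E \<Longrightarrow> reach H t x y"
  shows "p \<noteq> [] \<Longrightarrow> successively (\<lambda>x y. {x, y} \<in> E) p \<Longrightarrow> set p \<subseteq> X \<Longrightarrow>
    card (rt ` set p) \<le> Suc m \<Longrightarrow> reach H (Suc m * a + m * t) (hd p) (last p)"
proof (induction m arbitrary: p)
  case 0
  then have "card (rt ` set p) \<le> 1" "finite (rt ` set p)" by auto
  then have "rt (hd p) = rt (last p)"
    using 0(1) by (metis card_le_Suc0_iff_eq One_nat_def hd_in_set imageI last_in_set)
  then have "reach H a (hd p) (last p)"
    using 0 by (intro same) auto
  then show ?case by simp
next
  case (Suc m)
  have "\<exists>x\<in>set p. rt x = rt (hd p)" using Suc.prems(1) by force
  then obtain ys y zs where p: "p = ys @ y # zs" "rt y = rt (hd p)" "\<forall>z\<in>set zs. rt z \<noteq> rt (hd p)"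
    using split_list_last_prop[of p "\<lambda>x. rt x = rt (hd p)"] by blast
  have y: "reach H a (hd p) y" using same Suc.prems(1,3) p(1,2) by (metis hd_in_set in_set_conv_decomp subsetD)
  show ?case
  proof (cases "zs = []")
    case True
    then show ?thesis using y p(1) by (auto intro: reach_mono_length)
  next
    case False
    \<comment> \<open>\<open>y\<close> is the last vertex of the first class, so that class no
      longer occurs in \<open>zs\<close>: one jump and one crossing have used up one class.\<close>
    have "rt ` set zs \<subseteq> rt ` set p - {rt (hd p)}" using p by auto
    then have "card (rt ` set zs) \<le> card (rt ` set p - {rt (hd p)})" by (intro card_mono) auto
    moreover have "card (rt ` set p - {rt (hd p)}) = card (rt ` set p) - 1"
      using Suc.prems(1) by (intro card_Diff_singleton) auto
    ultimately have "card (rt ` set zs) \<le> Suc m" using Suc.prems(4) by linarith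
    then have r: "reach H (Suc m * a + m * t) (hd zs) (last zs)"
      using Suc.IH[of zs] Suc.prems False p(1) by (auto simp: successively_append_iff successively_Cons)
    have "{y, hd zs} \<in> E"
      using Suc.prems(2) p(1) False by (cases zs) (auto simp: successively_append_iff)
    then have "reach H (a + t + (Suc m * a + m * t)) (hd p) (last zs)"
      using y r edge by (meson reach_trans)
    moreover have "a + t + (Suc m * a + m * t) = Suc (Suc m) * a + Suc m * t" by (simp add: algebra_simps)
    moreover have "last zs = last p" using p(1) False by simp
    ultimately show ?thesis by metis
  qed
qed

text \<open>The parts of the tree left by the faults are the classes for
  \<open>reach_class_walk\<close>. Each part is represented by its topmost vertex, which is
  \<open>s\<close> or a vertex whose parent edge has failed.\<close>

lemma reach_tree_spanner:
  fixes F :: "'a set set"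
  assumes tree: "\<And>d. last_edges E s d UNIV H"
    and edge: "\<And>x y. {x, y} \<in> E - F \<Longrightarrow> reach (H - F) t x y"
    and F: "finite F" "card F \<le> f" and r: "reach (E - F) d s v"
  shows "reach (H - F) (2 * (f + 1) * d + f * t) s v"
proof -
  define X where "X = {x. \<exists>l. reach E l s x}"
  define lev where "lev x = (LEAST l. reach E l s x)" for x
  have lev: "reach E (lev x) s x" "lev x \<le> l" if "reach E l s x" for l x
    using that unfolding lev_def by (fact LeastI, fact Least_le)
  have "\<exists>w. lev x = Suc (lev w) \<and> {w, x} \<in> H \<and> w \<in> X" if x: "x \<in> X" "x \<noteq> s" for x
  proof -
    obtain l where l: "reach E l s x" using x unfolding X_def by auto
    then have "lev x \<noteq> 0" using lev(1)[OF l] x(2) by (metis reach.simps(1))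
    then obtain d where d: "lev x = Suc d" using not0_implies_Suc by blast
    then have "reach E (Suc d) s x" "\<not> reach E d s x" using lev[of _ x] l by (metis, metis Suc_n_not_le_n)
    then obtain w where w: "reach E d s w" "{w, x} \<in> E \<inter> H" using tree[of d] unfolding last_edges_def by auto
    then have "lev x \<le> Suc (lev w)" using lev[of _ w] lev(2)[of "Suc (lev w)" x] by auto
    then have "lev w = d" using lev(2)[OF w(1)] d by simp
    then show ?thesis using w d unfolding X_def by auto
  qed
  then obtain par where par: "\<And>x. x \<in> X \<Longrightarrow> x \<noteq> s \<Longrightarrow>
      lev x = Suc (lev (par x)) \<and> {par x, x} \<in> H \<and> par x \<in> X" by metis
  define cut where "cut = {x \<in> X. x \<noteq> s \<and> {par x, x} \<in> F}"
  \<comment> \<open>Levels drop strictly towards parents, so two vertices cannot be parents of each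
    other: each failed edge cuts off at most one vertex.\<close>
  have "inj_on (\<lambda>x. {par x, x}) cut"
  proof (rule inj_onI, rule ccontr)
    fix x y assume xy: "x \<in> cut" "y \<in> cut" "{par x, x} = {par y, y}" "x \<noteq> y"
    then have "par x = y" "par y = x" by (metis doubleton_eq_iff)+
    then show False using par[of x] par[of y] xy(1,2) unfolding cut_def by simp
  qed
  moreover have "(\<lambda>x. {par x, x}) ` cut \<subseteq> F" unfolding cut_def by auto
  ultimately have cut: "finite cut" "card cut \<le> f"
    using F by (meson inj_on_finite, meson card_inj_on_le le_trans)
  \<comment> \<open>Climb to parents until \<open>s\<close> or a vertex of \<open>cut\<close> is
    reached.\<close>
  have "\<exists>r\<in>insert s cut. reach (H - F) l r x" if "x \<in> X" "lev x = l" for x l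
    using that
  proof (induction l arbitrary: x)
    case 0
    then have "x = s" using lev(1)[of _ x] unfolding X_def by fastforce
    then show ?case by auto
  next
    case (Suc l)
    have "lev s = 0" using lev(2)[of 0 s] by simp
    then have "x \<noteq> s" using Suc.prems by auto
    note px = par[OF Suc.prems(1) this]
    show ?case
    proof (cases "x \<in> cut")
      case True
      then show ?thesis by (intro bexI[of _ x] reach_refl) auto
    next
      case False
      then have "{par x, x} \<in> H - F" using px \<open>x \<noteq> s\<close> Suc.prems unfolding cut_def by auto
      moreover obtain r where "r \<in> insert s cut" "reach (H - F) l r (par x)"
        using Suc.IH[of "par x"] px Suc.prems by auto
      ultimately show ?thesis by auto
    qed
  qed
  then obtain rt where rt: "\<And>x. x \<in> X \<Longrightarrow> rt x \<in> insert s cut \<and> reach (H - F) (lev x) (rt x) x"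
    by metis
  from reach_imp_walk[OF r] obtain p where p: "p \<noteq> []" "hd p = s" "last p = v"
     "successively (\<lambda>x y. {x, y} \<in> E - F) p" "\<And>x. x \<in> set p \<Longrightarrow> reach (E - F) d s x" by blast
  \<comment> \<open>Distances in \<open>E\<close> are at most those in \<open>E - F\<close>, so the
    walk stays in \<open>Y\<close>. Each of its vertices lies at most \<open>d\<close> below its
    representative, and two vertices of one part are at most \<open>2 d\<close> apart.\<close>
  define Y where "Y = {x. reach E d s x}"
  have YX: "Y \<subseteq> X" unfolding X_def Y_def by auto
  have up: "reach (H - F) d (rt x) x" if "x \<in> Y" for x
    using that rt[of x] YX lev(2)[of d x] unfolding Y_def by (auto intro: reach_mono_length)
  have "set p \<subseteq> Y" using p(5) unfolding Y_def by (auto intro: reach_mono)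
  then have "rt ` set p \<subseteq> insert s cut" using rt YX by blast
  then have "card (rt ` set p) \<le> card (insert s cut)" using cut by (intro card_mono) auto
  then have small: "card (rt ` set p) \<le> Suc f" using cut by (simp add: card_insert_if split: if_splits)
  have "reach (H - F) (d + d) x y" if "x \<in> Y" "y \<in> Y" "rt x = rt y" for x y
    using reach_trans[OF reach_sym[OF up[OF that(1)]]] up[OF that(2)] that(3) by simp
  then have "reach (H - F) (Suc f * (d + d) + f * t) (hd p) (last p)"
    using reach_class_walk[OF _ edge p(1,4) \<open>set p \<subseteq> Y\<close> small] by blast
  moreover have "Suc f * (d + d) + f * t = 2 * (f + 1) * d + f * t" by (simp add: algebra_simps)
  ultimately show ?thesis using p(2,3) by metis
qed

text \<open>Pigeonhole: \<open>f\<close> faults cannot hit all of \<open>f + 1\<close> disjoint edge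
  sets.\<close>

lemma reach_disjoint_spanners:
  fixes S :: "nat \<Rightarrow> 'a set set"
  assumes span: "\<And>i. i \<le> f \<Longrightarrow> reach (S i) t x y" "\<And>i. i \<le> f \<Longrightarrow> S i \<subseteq> H"
    and disj: "\<And>i j. i \<noteq> j \<Longrightarrow> S i \<inter> S j = {}" and F: "finite F" "card F \<le> f"
  shows "reach (H - F) t x y"
proof -
  have "\<exists>i\<le>f. S i \<inter> F = {}"
  proof (rule ccontr)
    assume "\<not> ?thesis"
    then have "\<forall>i\<in>{..f}. \<exists>e. e \<in> S i \<inter> F" by auto
    then obtain g where g: "\<And>i. i \<le> f \<Longrightarrow> g i \<in> S i \<inter> F" by (metis atMost_iff)
    then have "inj_on g {..f}" using disj by (intro inj_onI) (metis IntD1 atMost_iff disjoint_iff)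
    moreover have "g ` {..f} \<subseteq> F" using g by auto
    ultimately have "card {..f} \<le> card F" using F(1) card_inj_on_le by metis
    then show False using F(2) by simp
  qed
  then obtain i where "i \<le> f" "S i \<inter> F = {}" by blast
  then show ?thesis using span reach_mono[of "S i" t x y "H - F"] by blast
qed

subsection \<open>Reasoning about programs\<close>

text \<open>\<open>ws c\<close> and \<open>wa c\<close> are the scalars and arrays that \<open>c\<close> may write.\<close>

primrec ws :: "com \<Rightarrow> vname set" where
  "ws Skip = {}"
| "ws (Assign x e) = {x}"
| "ws (Store a i j e) = {}"
| "ws (Seq c1 c2) = ws c1 \<union> ws c2"
| "ws (Cond b c1 c2) = ws c1 \<union> ws c2"
| "ws (While b c) = ws c"

primrec wa :: "com \<Rightarrow> vname set" where
  "wa Skip = {}"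
| "wa (Assign x e) = {}"
| "wa (Store a i j e) = {a}"
| "wa (Seq c1 c2) = wa c1 \<union> wa c2"
| "wa (Cond b c1 c2) = wa c1 \<union> wa c2"
| "wa (While b c) = wa c"

lemma scal_set_scal [simp]: "scal (set_scal x m \<sigma>) = (scal \<sigma>)(x := m)"
  and arr_set_scal [simp]: "arr (set_scal x m \<sigma>) = arr \<sigma>"
  and scal_set_cell [simp]: "scal (set_cell a i j m \<sigma>) = scal \<sigma>"
  and arr_set_cell [simp]: "arr (set_cell a i j m \<sigma>) = (arr \<sigma>)(a := (arr \<sigma> a)(i := (arr \<sigma> a i)(j := m)))"
  by (simp_all add: set_scal_def set_cell_def)

definition agree :: "com \<Rightarrow> state \<Rightarrow> state \<Rightarrow> bool" where
  "agree c \<sigma> \<sigma>' \<longleftrightarrow> (\<forall>x. x \<notin> ws c \<longrightarrow> scal \<sigma>' x = scal \<sigma> x) \<and> (\<forall>a. a \<notin> wa c \<longrightarrow> arr \<sigma>' a = arr \<sigma> a)"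

lemma agree_scal: "agree c \<sigma> \<sigma>' \<Longrightarrow> x \<notin> ws c \<Longrightarrow> scal \<sigma>' x = scal \<sigma> x"
  and agree_arr: "agree c \<sigma> \<sigma>' \<Longrightarrow> a \<notin> wa c \<Longrightarrow> arr \<sigma>' a = arr \<sigma> a"
  unfolding agree_def by auto

lemma exec_agree: "exec c \<sigma> t \<sigma>' \<Longrightarrow> agree c \<sigma> \<sigma>'"
  unfolding agree_def by (induction rule: exec.induct) auto

text \<open>Correctness is proved for every final state with the step count forgotten, and time
  bounds are proved separately through \<open>polytime\<close>; the final theorem applies the former
  to the run supplied by the latter.\<close>

definition runs :: "com \<Rightarrow> state \<Rightarrow> state \<Rightarrow> bool" where
  "runs c \<sigma> \<sigma>' \<longleftrightarrow> (\<exists>t. exec c \<sigma> t \<sigma>')"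

lemma runs_agree: "runs c \<sigma> \<sigma>' \<Longrightarrow> agree c \<sigma> \<sigma>'"
  unfolding runs_def using exec_agree by blast

inductive_cases exec_SkipE: "exec Skip \<sigma> t \<sigma>'"
inductive_cases exec_AssignE: "exec (Assign x e) \<sigma> t \<sigma>'"
inductive_cases exec_StoreE: "exec (Store a i j e) \<sigma> t \<sigma>'"
inductive_cases exec_SeqE: "exec (Seq c1 c2) \<sigma> t \<sigma>'"
inductive_cases exec_CondE: "exec (Cond b c1 c2) \<sigma> t \<sigma>'"

lemma runs_Skip [simp]: "runs Skip \<sigma> \<sigma>' \<longleftrightarrow> \<sigma>' = \<sigma>"
  unfolding runs_def by (auto elim: exec_SkipE intro: exec.Skip)

lemma runs_Assign [simp]: "runs (Assign x e) \<sigma> \<sigma>' \<longleftrightarrow> \<sigma>' = set_scal x (aval e \<sigma>) \<sigma>"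
  unfolding runs_def by (auto elim: exec_AssignE intro: exec.Assign)

lemma runs_Store [simp]:
  "runs (Store a i j e) \<sigma> \<sigma>' \<longleftrightarrow> \<sigma>' = set_cell a (aval i \<sigma>) (aval j \<sigma>) (aval e \<sigma>) \<sigma>"
  unfolding runs_def by (auto elim: exec_StoreE intro: exec.Store)

lemma runs_Seq: "runs (Seq c1 c2) \<sigma> \<sigma>' \<longleftrightarrow> (\<exists>\<sigma>1. runs c1 \<sigma> \<sigma>1 \<and> runs c2 \<sigma>1 \<sigma>')"
  unfolding runs_def by (auto elim!: exec_SeqE intro: exec.Seq)

lemma runs_SeqE:
  assumes "runs (Seq c1 c2) \<sigma> \<sigma>'"
  obtains \<sigma>1 where "runs c1 \<sigma> \<sigma>1" "runs c2 \<sigma>1 \<sigma>'"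
  using assms unfolding runs_Seq by auto

lemma runs_Cond:
  "runs (Cond b c1 c2) \<sigma> \<sigma>' \<longleftrightarrow> (if aval b \<sigma> \<noteq> 0 then runs c1 \<sigma> \<sigma>' else runs c2 \<sigma> \<sigma>')"
  unfolding runs_def by (auto elim: exec_CondE intro: exec.CondTrue exec.CondFalse)

lemma runs_While:
  assumes "runs (While b c) \<sigma> \<sigma>'" "J \<sigma>"
    and step: "\<And>\<sigma>1 \<sigma>2. J \<sigma>1 \<Longrightarrow> aval b \<sigma>1 \<noteq> 0 \<Longrightarrow> runs c \<sigma>1 \<sigma>2 \<Longrightarrow> J \<sigma>2"
  shows "J \<sigma>' \<and> aval b \<sigma>' = 0"
proof -
  obtain t where "exec (While b c) \<sigma> t \<sigma>'" using assms(1) unfolding runs_def by blast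
  then show ?thesis using assms(2)
  proof (induction "While b c" \<sigma> t \<sigma>' rule: exec.induct)
    case (WhileTrue \<sigma> t1 \<sigma>1 t2 \<sigma>2)
    then show ?case using step unfolding runs_def by blast
  qed simp
qed

text \<open>Truncated subtraction serves as the test \<open>x < b\<close>.\<close>

definition For :: "vname \<Rightarrow> aexp \<Rightarrow> com \<Rightarrow> com" where
  "For x b c = Seq (Assign x (Num 0)) (While (Minus b (Var x)) (Seq c (Assign x (Plus (Var x) (Num 1)))))"

lemma ws_For [simp]: "ws (For x b c) = insert x (ws c)"
  and wa_For [simp]: "wa (For x b c) = wa c"
  unfolding For_def by auto

text \<open>Such a bound has a value polynomial in \<open>n\<close> and keeps it as long as
  \<open>n\<close> is not written.\<close>

definition loop_bound :: "aexp \<Rightarrow> bool" where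
  "loop_bound b \<longleftrightarrow> b = Var ''n'' \<or> (\<exists>N. b = Num N)"

lemma loop_bound_simps [simp]: "loop_bound (Var ''n'')" "loop_bound (Num N)"
  unfolding loop_bound_def by auto

lemma aval_loop_bound: "loop_bound b \<Longrightarrow> scal \<sigma>' ''n'' = scal \<sigma> ''n'' \<Longrightarrow> aval b \<sigma>' = aval b \<sigma>"
  unfolding loop_bound_def by auto

text \<open>The premise on \<open>set_scal\<close> carries the invariant across updates of the
  counter. The \<open>agree\<close> fact handed to each step supplies the values of everything the
  loop does not write, so invariants can stay small.\<close>

lemma runs_For:
  assumes run: "runs (For x b c) \<sigma> \<sigma>'" and b: "loop_bound b" "aval b \<sigma> = N"
    and x: "x \<notin> ws c" "''n'' \<notin> ws c" "x \<noteq> ''n''" and base: "I 0 \<sigma>"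
    and upd: "\<And>i \<sigma>1 m. I i \<sigma>1 \<Longrightarrow> I i (set_scal x m \<sigma>1)"
    and step: "\<And>i \<sigma>1 \<sigma>2. i < N \<Longrightarrow> I i \<sigma>1 \<Longrightarrow> scal \<sigma>1 x = i \<Longrightarrow> agree (For x b c) \<sigma> \<sigma>1 \<Longrightarrow>
      runs c \<sigma>1 \<sigma>2 \<Longrightarrow> I (Suc i) \<sigma>2"
  shows "I N \<sigma>'"
proof -
  let ?w = "While (Minus b (Var x)) (Seq c (Assign x (Plus (Var x) (Num 1))))"
  let ?J = "\<lambda>\<sigma>1. scal \<sigma>1 x \<le> N \<and> I (scal \<sigma>1 x) \<sigma>1 \<and> agree (For x b c) \<sigma> \<sigma>1"
  have n: "aval b \<sigma>1 = N" if "agree (For x b c) \<sigma> \<sigma>1" for \<sigma>1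
    using aval_loop_bound[OF b(1), of \<sigma>1 \<sigma>] agree_scal[OF that, of "''n''"] x b(2) by simp
  have "runs ?w (set_scal x 0 \<sigma>) \<sigma>'" using run unfolding For_def runs_Seq by simp
  moreover have "?J (set_scal x 0 \<sigma>)" using base upd unfolding agree_def by auto
  ultimately have "?J \<sigma>' \<and> aval (Minus b (Var x)) \<sigma>' = 0"
  proof (rule runs_While)
    fix \<sigma>1 \<sigma>2 assume J: "?J \<sigma>1" and lt: "aval (Minus b (Var x)) \<sigma>1 \<noteq> 0"
      and r: "runs (Seq c (Assign x (Plus (Var x) (Num 1)))) \<sigma>1 \<sigma>2"
    from r obtain \<sigma>3 where \<sigma>3: "runs c \<sigma>1 \<sigma>3" "\<sigma>2 = set_scal x (Suc (scal \<sigma>3 x)) \<sigma>3"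
      unfolding runs_Seq by auto
    have lt: "scal \<sigma>1 x < N" using lt n J by auto
    have a: "agree c \<sigma>1 \<sigma>3" using \<sigma>3(1) by (rule runs_agree)
    then have "scal \<sigma>3 x = scal \<sigma>1 x" using agree_scal x by blast
    moreover have "I (Suc (scal \<sigma>1 x)) \<sigma>3" using step[OF lt _ _ _ \<sigma>3(1)] J by blast
    moreover have "agree (For x b c) \<sigma> \<sigma>2" using J a unfolding \<sigma>3(2) agree_def by auto
    ultimately show "?J \<sigma>2" using lt upd unfolding \<sigma>3(2) by auto
  qed
  then show ?thesis using n[of \<sigma>'] by auto
qed

section \<open>Polynomial running time\<close>

definition polytime :: "com \<Rightarrow> bool" where
  "polytime c \<longleftrightarrow> ''n'' \<notin> ws c \<and> (\<exists>q. \<forall>\<sigma>. \<exists>t \<sigma>'. exec c \<sigma> t \<sigma>' \<and> t \<le> poly q (scal \<sigma> ''n''))"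

lemma polytimeI:
  assumes "''n'' \<notin> ws c" "\<And>\<sigma>. \<exists>t \<sigma>'. exec c \<sigma> t \<sigma>' \<and> t \<le> poly q (scal \<sigma> ''n'')"
  shows "polytime c"
  using assms unfolding polytime_def by blast

lemma polytime_ws: "polytime c \<Longrightarrow> ''n'' \<notin> ws c"
  unfolding polytime_def by blast

lemma polytime_Skip: "polytime Skip"
  unfolding polytime_def by (auto intro!: exI[of _ "[:1:]"] exec.Skip)

lemma polytime_Assign: "x \<noteq> ''n'' \<Longrightarrow> polytime (Assign x e)"
  unfolding polytime_def by (auto intro!: exI[of _ "[:1:]"] exec.Assign)

lemma polytime_Store: "polytime (Store a i j e)"
  unfolding polytime_def by (auto intro!: exI[of _ "[:1:]"] exec.Store)

lemma polytime_Seq: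
  assumes "polytime c1" "polytime c2"
  shows "polytime (Seq c1 c2)"
proof -
  obtain q1 q2 where q: "\<And>\<sigma>. \<exists>t \<sigma>'. exec c1 \<sigma> t \<sigma>' \<and> t \<le> poly q1 (scal \<sigma> ''n'')"
    "\<And>\<sigma>. \<exists>t \<sigma>'. exec c2 \<sigma> t \<sigma>' \<and> t \<le> poly q2 (scal \<sigma> ''n'')"
    using assms unfolding polytime_def by blast
  have "\<exists>t \<sigma>'. exec (Seq c1 c2) \<sigma> t \<sigma>' \<and> t \<le> poly (q1 + q2) (scal \<sigma> ''n'')" for \<sigma>
  proof -
    obtain t1 \<sigma>1 where 1: "exec c1 \<sigma> t1 \<sigma>1" "t1 \<le> poly q1 (scal \<sigma> ''n'')" using q(1) by blast
    obtain t2 \<sigma>2 where 2: "exec c2 \<sigma>1 t2 \<sigma>2" "t2 \<le> poly q2 (scal \<sigma>1 ''n'')" using q(2) by blast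
    have "scal \<sigma>1 ''n'' = scal \<sigma> ''n''"
      using agree_scal[OF exec_agree[OF 1(1)]] assms(1) unfolding polytime_def by blast
    then have "t1 + t2 \<le> poly (q1 + q2) (scal \<sigma> ''n'')" using 1 2 by simp
    then show ?thesis using exec.Seq[OF 1(1) 2(1)] by blast
  qed
  then show ?thesis using polytime_ws assms by (intro polytimeI[where q = "q1 + q2"]) simp_all
qed

lemma polytime_Cond:
  assumes "polytime c1" "polytime c2"
  shows "polytime (Cond b c1 c2)"
proof -
  obtain q1 q2 where q: "\<And>\<sigma>. \<exists>t \<sigma>'. exec c1 \<sigma> t \<sigma>' \<and> t \<le> poly q1 (scal \<sigma> ''n'')"
    "\<And>\<sigma>. \<exists>t \<sigma>'. exec c2 \<sigma> t \<sigma>' \<and> t \<le> poly q2 (scal \<sigma> ''n'')"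
    using assms unfolding polytime_def by blast
  have "\<exists>t \<sigma>'. exec (Cond b c1 c2) \<sigma> t \<sigma>' \<and> t \<le> poly ([:1:] + q1 + q2) (scal \<sigma> ''n'')" for \<sigma>
  proof (cases "aval b \<sigma> = 0")
    case True
    obtain t \<sigma>' where "exec c2 \<sigma> t \<sigma>'" "t \<le> poly q2 (scal \<sigma> ''n'')" using q(2) by blast
    then show ?thesis using True by (intro exI[of _ "Suc t"] exI[of _ \<sigma>']) (auto intro: exec.CondFalse)
  next
    case False
    obtain t \<sigma>' where "exec c1 \<sigma> t \<sigma>'" "t \<le> poly q1 (scal \<sigma> ''n'')" using q(1) by blast
    then show ?thesis using False by (intro exI[of _ "Suc t"] exI[of _ \<sigma>']) (auto intro: exec.CondTrue)
  qed
  then show ?thesis using polytime_ws assms by (intro polytimeI[where q = "[:1:] + q1 + q2"]) simp_all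
qed

text \<open>The bound for \<open>c\<close> holds from every state with the same \<open>n\<close>,
  hence in each round, whatever earlier rounds left in memory. The number of rounds is a polynomial
  too, so the product is one.\<close>

lemma polytime_For:
  assumes c: "polytime c" and x: "x \<notin> ws c" "x \<noteq> ''n''" and b: "loop_bound b"
  shows "polytime (For x b c)"
proof -
  obtain q where q: "\<And>\<sigma>. \<exists>t \<sigma>'. exec c \<sigma> t \<sigma>' \<and> t \<le> poly q (scal \<sigma> ''n'')"
    using c unfolding polytime_def by blast
  have n: "''n'' \<notin> ws c" using c unfolding polytime_def by blast
  let ?b = "Minus b (Var x)" and ?c = "Seq c (Assign x (Plus (Var x) (Num 1)))"
  \<comment> \<open>Induction on the number \<open>r\<close> of remaining rounds. The
    \<open>+ 2\<close> pays for the test and the increment, the \<open>+ 1\<close> for the final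
    failing test.\<close>
  have while: "\<exists>t \<sigma>'. exec (While ?b ?c) \<sigma> t \<sigma>' \<and> t \<le> r * (poly q (scal \<sigma> ''n'') + 2) + 1"
    if "aval ?b \<sigma> = r" for r \<sigma>
    using that
  proof (induction r arbitrary: \<sigma>)
    case 0
    then show ?case using exec.WhileFalse by force
  next
    case (Suc r)
    obtain t1 \<sigma>1 where 1: "exec c \<sigma> t1 \<sigma>1" "t1 \<le> poly q (scal \<sigma> ''n'')" using q by blast
    let ?\<sigma>2 = "set_scal x (aval (Plus (Var x) (Num 1)) \<sigma>1) \<sigma>1"
    have sc: "scal \<sigma>1 ''n'' = scal \<sigma> ''n''" "scal \<sigma>1 x = scal \<sigma> x"
      using agree_scal[OF exec_agree[OF 1(1)]] n x by auto
    then have "aval b ?\<sigma>2 = aval b \<sigma>" using aval_loop_bound[OF b, of ?\<sigma>2 \<sigma>] x by simp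
    then have "aval ?b ?\<sigma>2 = r" using Suc.prems sc by simp
    then obtain t3 \<sigma>3 where 3: "exec (While ?b ?c) ?\<sigma>2 t3 \<sigma>3"
      "t3 \<le> r * (poly q (scal ?\<sigma>2 ''n'') + 2) + 1" using Suc.IH by blast
    have "exec (While ?b ?c) \<sigma> (Suc (t1 + 1 + t3)) \<sigma>3"
      using Suc.prems by (intro exec.WhileTrue[OF _ exec.Seq[OF 1(1) exec.Assign] 3(1)]) simp
    moreover have "Suc (t1 + 1 + t3) \<le> Suc r * (poly q (scal \<sigma> ''n'') + 2) + 1"
      using 1(2) 3(2) sc(1) x by simp
    ultimately show ?case by blast
  qed
  obtain p :: "nat poly" where p: "\<And>\<sigma>. aval b \<sigma> = poly p (scal \<sigma> ''n'')"
  proof (cases "b = Var ''n''")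
    case True
    then show ?thesis using that[of "[:0, 1:]"] by simp
  next
    case False
    then obtain N where "b = Num N" using b unfolding loop_bound_def by blast
    then show ?thesis using that[of "[:N:]"] by simp
  qed
  have "\<exists>t \<sigma>'. exec (For x b c) \<sigma> t \<sigma>' \<and> t \<le> poly (p * (q + [:2:]) + [:2:]) (scal \<sigma> ''n'')" for \<sigma>
  proof -
    let ?\<sigma>1 = "set_scal x (aval (Num 0) \<sigma>) \<sigma>"
    have n1: "scal ?\<sigma>1 ''n'' = scal \<sigma> ''n''" using x by simp
    have "aval ?b ?\<sigma>1 = poly p (scal \<sigma> ''n'')" using p[of ?\<sigma>1] n1 by simp
    from while[OF this] n1 obtain t \<sigma>' where t: "exec (While ?b ?c) ?\<sigma>1 t \<sigma>'"
      "t \<le> poly p (scal \<sigma> ''n'') * (poly q (scal \<sigma> ''n'') + 2) + 1" by metis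
    have "exec (For x b c) \<sigma> (1 + t) \<sigma>'"
      unfolding For_def by (rule exec.Seq[OF exec.Assign t(1)])
    then show ?thesis using t(2) by (intro exI[of _ "1 + t"] exI[of _ \<sigma>']) auto
  qed
  then show ?thesis using n x(2) by (intro polytimeI[where q = "p * (q + [:2:]) + [:2:]"]) simp_all
qed

lemmas polytime_intros = polytime_Skip polytime_Assign polytime_Store polytime_Seq polytime_Cond polytime_For

subsection \<open>The algorithm\<close>

text \<open>The two truncated differences add up to the absolute difference.\<close>

definition eqv :: "aexp \<Rightarrow> aexp \<Rightarrow> aexp" where
  "eqv a b = Minus (Num 1) (Plus (Minus a b) (Minus b a))"

lemma aval_eqv [simp]: "aval (eqv a b) \<sigma> = (if aval a \<sigma> = aval b \<sigma> then 1 else 0)"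
  unfolding eqv_def by auto

text \<open>The cell \<open>(l, v)\<close> of the array \<open>T\<close> records whether \<open>v\<close> is within distance \<open>l\<close> of the source
  \<open>r\<close>; the expression \<open>e\<close> tests whether the vertices held by \<open>p\<close> and \<open>q\<close> are adjacent.\<close>

definition bfs :: "vname \<Rightarrow> aexp \<Rightarrow> com" where
  "bfs r e = Seq
     (For ''q'' (Var ''n'') (Store ''T'' (Num 0) (Var ''q'') (eqv (Var r) (Var ''q''))))
     (For ''l'' (Var ''n'') (For ''q'' (Var ''n'') (Seq
        (Store ''T'' (Plus (Var ''l'') (Num 1)) (Var ''q'') (Cell ''T'' (Var ''l'') (Var ''q'')))
        (For ''p'' (Var ''n'') (Cond (Cell ''T'' (Var ''l'') (Var ''p''))
           (Cond e (Store ''T'' (Plus (Var ''l'') (Num 1)) (Var ''q'') (Num 1)) Skip) Skip)))))"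

text \<open>The cell \<open>(u, v)\<close> of the array \<open>L\<close> is \<open>i + 1\<close> if the edge belongs to the \<open>i\<close>-th spanner, and
  \<open>0\<close> if it belongs to none.\<close>

definition greedy_step :: com where
  "greedy_step = Seq
     (bfs ''u'' (eqv (Cell ''L'' (Var ''p'') (Var ''q'')) (Plus (Var ''i'') (Num 1))))
     (Cond (Cell ''G'' (Var ''u'') (Var ''v'')) (Cond (Cell ''L'' (Var ''u'') (Var ''v'')) Skip
       (Cond (Cell ''T'' (Var ''t'') (Var ''v'')) Skip
         (Seq (Store ''L'' (Var ''u'') (Var ''v'') (Plus (Var ''i'') (Num 1)))
         (Seq (Store ''L'' (Var ''v'') (Var ''u'') (Plus (Var ''i'') (Num 1)))
         (Seq (Store ''H'' (Var ''u'') (Var ''v'') (Num 1))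
              (Store ''H'' (Var ''v'') (Var ''u'') (Num 1))))))) Skip)"

definition spanners :: "nat \<Rightarrow> com" where
  "spanners f = For ''i'' (Num (Suc f)) (For ''u'' (Var ''n'') (For ''v'' (Var ''n'') greedy_step))"

text \<open>The array \<open>X\<close> counts how often an edge is currently deleted, so adjacency in \<open>G \<setminus> F\<close> is a
  truncated difference.\<close>

definition adjX :: "vname \<Rightarrow> vname \<Rightarrow> aexp" where
  "adjX p q = Minus (Cell ''G'' (Var p) (Var q)) (Cell ''X'' (Var p) (Var q))"

text \<open>The candidate \<open>w\<close> is stored as \<open>c = w + 1\<close>; a later candidate replaces it only if its edge to
  \<open>v\<close> is in \<open>H\<close>.\<close>

definition scan :: com where
  "scan = Cond (Cell ''T'' (Var ''d'') (Var ''w'')) (Cond (adjX ''w'' ''v'')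
     (Cond (Plus (Minus (Num 1) (Var ''c'')) (Cell ''H'' (Var ''w'') (Var ''v'')))
        (Assign ''c'' (Plus (Var ''w'') (Num 1))) Skip) Skip) Skip"

text \<open>Run only for a vertex in layer \<open>d + 1\<close>; then a candidate is found and
  \<open>c - 1\<close> is a genuine vertex.\<close>

definition pick :: com where
  "pick = Seq (Assign ''c'' (Num 0)) (Seq (For ''w'' (Var ''n'') scan)
     (Seq (Store ''H'' (Minus (Var ''c'') (Num 1)) (Var ''v'') (Num 1))
          (Store ''H'' (Var ''v'') (Minus (Var ''c'') (Num 1)) (Num 1))))"

text \<open>Rows of \<open>T\<close> are cumulative 0-1 vectors, so the difference of rows
  \<open>d + 1\<close> and \<open>d\<close> singles out the vertices at distance exactly
  \<open>d + 1\<close>.\<close>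

definition add_last_edges :: com where
  "add_last_edges = Seq (bfs ''s'' (adjX ''p'' ''q''))
     (For ''v'' (Var ''n'') (Cond
        (Minus (Cell ''T'' (Plus (Var ''d'') (Num 1)) (Var ''v'')) (Cell ''T'' (Var ''d'') (Var ''v'')))
        pick Skip))"

text \<open>The loop variables of the \<open>2 f\<close> nested loops that enumerate the fault sets.\<close>

definition zv :: "nat \<Rightarrow> vname" where
  "zv j = replicate (Suc j) (CHR ''z'')"

lemma zv_eq_iff [simp]: "zv i = zv j \<longleftrightarrow> i = j"
  unfolding zv_def by (metis length_replicate nat.inject)

lemma zv_neq [simp]: "c \<noteq> CHR ''z'' \<Longrightarrow> zv j \<noteq> c # cs" "c \<noteq> CHR ''z'' \<Longrightarrow> c # cs \<noteq> zv j"
  unfolding zv_def by auto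

text \<open>The second store copies the updated cell instead of applying \<open>g\<close> again;
  otherwise \<open>g\<close> would act twice when both vertices coincide.\<close>

definition bump :: "(aexp \<Rightarrow> aexp) \<Rightarrow> vname \<Rightarrow> vname \<Rightarrow> com" where
  "bump g x y = Seq (Store ''X'' (Var x) (Var y) (g (Cell ''X'' (Var x) (Var y))))
     (Store ''X'' (Var y) (Var x) (Cell ''X'' (Var x) (Var y)))"

text \<open>Each level marks an arbitrary ordered pair, which may be a non-edge, a loop or a
  repetition. This covers all sets of at most \<open>m\<close> edges with \<open>2 * m\<close>
  loops, polynomial for constant \<open>m\<close>. The outer level takes the largest indices, so the
  inner nest uses counters below \<open>2 * m\<close> only.\<close>

primrec nest :: "nat \<Rightarrow> com \<Rightarrow> com" where
  "nest 0 c = c"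
| "nest (Suc m) c = For (zv (2 * m)) (Var ''n'') (For (zv (2 * m + 1)) (Var ''n'')
     (Seq (bump (\<lambda>a. Plus a (Num 1)) (zv (2 * m)) (zv (2 * m + 1)))
     (Seq (nest m c) (bump (\<lambda>a. Minus a (Num 1)) (zv (2 * m)) (zv (2 * m + 1))))))"

text \<open>The distance bound is tested inside a loop up to \<open>n\<close>, since
  \<open>loop_bound\<close> admits only \<open>n\<close> and constants.\<close>

definition phase :: "nat \<Rightarrow> vname \<Rightarrow> com" where
  "phase m b = For ''d'' (Var ''n'') (Cond (Minus (Var b) (Var ''d'')) (nest m add_last_edges) Skip)"

primrec times :: "nat \<Rightarrow> aexp \<Rightarrow> aexp" where
  "times 0 e = Num 0"
| "times (Suc m) e = Plus e (times m e)"

lemma aval_times [simp]: "aval (times m e) \<sigma> = m * aval e \<sigma>"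
  by (induction m) auto

text \<open>In step, \<open>p\<close> runs through \<open>4 ^ \<kappa>\<close> and \<open>t\<close>
  through \<open>2 * \<kappa> - 1\<close>, until \<open>p\<close> reaches \<open>n\<close>.\<close>

definition log_stretch :: com where
  "log_stretch = Seq (Assign ''t'' (Num 1)) (Seq (Assign ''p'' (Num 4)) (For ''l'' (Var ''n'')
     (Cond (Minus (Var ''n'') (Var ''p''))
       (Seq (Assign ''p'' (times 4 (Var ''p''))) (Assign ''t'' (Plus (Var ''t'') (Num 2)))) Skip)))"

text \<open>By truncated subtraction, \<open>n - (n - x)\<close> is \<open>min n x\<close>, and \<open>b = 0\<close> if \<open>k = 0\<close>.\<close>

definition params :: "nat \<Rightarrow> com" where
  "params f = Seq (Assign ''t'' (Minus (times 4 (Var ''k'')) (Num 1)))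
     (Seq (Assign ''b'' (Minus (Var ''n'') (Minus (Var ''n'')
        (times (Suc f) (Minus (times 2 (Var ''k'')) (Num 1))))))
     (Seq (Cond (Var ''k'') Skip log_stretch)
       (Assign ''t'' (Minus (Var ''n'') (Minus (Var ''n'') (Var ''t''))))))"

text \<open>With no fault sets and no bound on the distance, the last-edge phase builds a BFS tree.\<close>

definition algorithm :: "nat \<Rightarrow> com" where
  "algorithm f = Seq (params f) (Seq (spanners f) (Seq (phase 0 ''n'') (phase f ''b'')))"

lemma ws_bfs [simp]: "ws (bfs r e) = {''p'', ''q'', ''l''}" and wa_bfs [simp]: "wa (bfs r e) = {''T''}"
  unfolding bfs_def by auto

lemma ws_nest [simp]: "ws (nest m c) = ws c \<union> zv ` {..<2 * m}"
  by (induction m) (auto simp: bump_def lessThan_Suc)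

lemma ws_add_last_edges [simp]: "ws add_last_edges = {''p'', ''q'', ''l'', ''v'', ''c'', ''w''}"
  and wa_add_last_edges [simp]: "wa add_last_edges = {''T'', ''H''}"
  unfolding add_last_edges_def pick_def scan_def by auto

lemma ws_greedy_step [simp]: "ws greedy_step = {''p'', ''q'', ''l''}"
  and wa_greedy_step [simp]: "wa greedy_step = {''T'', ''L'', ''H''}"
  unfolding greedy_step_def by auto

lemma polytime_bfs: "polytime (bfs r e)"
  unfolding bfs_def by (intro polytime_intros; simp)

lemma polytime_nest: "polytime c \<Longrightarrow> (\<And>j. zv j \<notin> ws c) \<Longrightarrow> polytime (nest m c)"
  by (induction m) (auto simp: bump_def intro!: polytime_intros)

lemma polytime_algorithm: "polytime (algorithm f)"
proof -
  have "polytime greedy_step"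
    unfolding greedy_step_def by (intro polytime_intros polytime_bfs; simp)
  then have "polytime (spanners f)"
    unfolding spanners_def by (intro polytime_intros; simp)
  moreover have "polytime add_last_edges"
    unfolding add_last_edges_def pick_def scan_def by (intro polytime_intros polytime_bfs; simp)
  then have "polytime (phase m b)" for m b
    unfolding phase_def by (intro polytime_intros polytime_nest; auto)
  moreover have "polytime (params f)"
    unfolding params_def log_stretch_def by (intro polytime_intros; simp)
  ultimately show ?thesis unfolding algorithm_def by (intro polytime_intros)
qed

subsection \<open>Correctness of the spanners\<close>

lemma agree_trans:
  "agree c1 \<sigma> \<sigma>1 \<Longrightarrow> agree c2 \<sigma>1 \<sigma>2 \<Longrightarrow> ws c1 \<union> ws c2 \<subseteq> ws c \<Longrightarrow> wa c1 \<union> wa c2 \<subseteq> wa c \<Longrightarrow>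
    agree c \<sigma> \<sigma>2"
  unfolding agree_def by (auto simp: subset_iff) metis+

text \<open>The test \<open>e\<close> is constrained only in states that differ from \<sigma> in
  what the search itself writes, so it may depend on the arrays \<open>G\<close>, \<open>L\<close>
  or \<open>X\<close> held fixed meanwhile.\<close>

lemma bfs_correct:
  assumes run: "runs (bfs r e) \<sigma> \<sigma>'" and n: "scal \<sigma> ''n'' = n"
    and r: "scal \<sigma> r = s" "s < n" "r \<notin> {''p'', ''q'', ''l''}"
    and e: "\<And>\<sigma>1. agree (bfs r e) \<sigma> \<sigma>1 \<Longrightarrow> scal \<sigma>1 ''p'' < n \<Longrightarrow> scal \<sigma>1 ''q'' < n \<Longrightarrow>
      aval e \<sigma>1 \<noteq> 0 \<longleftrightarrow> {scal \<sigma>1 ''p'', scal \<sigma>1 ''q''} \<in> A"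
    and A: "\<And>e. e \<in> A \<Longrightarrow> e \<subseteq> {..<n}" and iv: "i \<le> n" "v < n"
  shows "arr \<sigma>' ''T'' i v = of_bool (reach A i s v)"
proof -
  let ?row = "Store ''T'' (Num 0) (Var ''q'') (eqv (Var r) (Var ''q''))"
  let ?scan = "Cond (Cell ''T'' (Var ''l'') (Var ''p''))
    (Cond e (Store ''T'' (Plus (Var ''l'') (Num 1)) (Var ''q'') (Num 1)) Skip) Skip"
  let ?copy = "Store ''T'' (Plus (Var ''l'') (Num 1)) (Var ''q'') (Cell ''T'' (Var ''l'') (Var ''q''))"
  let ?p = "For ''p'' (Var ''n'') ?scan"
  let ?q = "For ''q'' (Var ''n'') (Seq ?copy ?p)"
  let ?l = "For ''l'' (Var ''n'') ?q"
  let ?b = "bfs r e"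
  let ?R = "\<lambda>i v. of_bool (reach A i s v) :: nat"
  define I where "I i \<sigma> \<longleftrightarrow> (\<forall>i'\<le>i. \<forall>v<n. arr \<sigma> ''T'' i' v = ?R i' v)" for i and \<sigma> :: state
  from run obtain \<sigma>0 where run0: "runs (For ''q'' (Var ''n'') ?row) \<sigma> \<sigma>0" and run1: "runs ?l \<sigma>0 \<sigma>'"
    unfolding bfs_def by (rule runs_SeqE)
  have ag0: "agree ?b \<sigma> \<sigma>0" using runs_agree[OF run0] unfolding agree_def by simp
  have n0: "scal \<sigma>0 ''n'' = n" using agree_scal[OF ag0, of "''n''"] n by simp
  have "\<forall>v<n. arr \<sigma>0 ''T'' 0 v = ?R 0 v"
  proof (rule runs_For[OF run0, where I = "\<lambda>j \<tau>. \<forall>v<j. arr \<tau> ''T'' 0 v = ?R 0 v"])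
    fix j \<sigma>1 \<sigma>2
    assume h: "\<forall>v<j. arr \<sigma>1 ''T'' 0 v = ?R 0 v" "scal \<sigma>1 ''q'' = j"
      "agree (For ''q'' (Var ''n'') ?row) \<sigma> \<sigma>1" "runs ?row \<sigma>1 \<sigma>2"
    have "scal \<sigma>1 r = s" using agree_scal[OF h(3), of r] r by simp
    then show "\<forall>v<Suc j. arr \<sigma>2 ''T'' 0 v = ?R 0 v" using h by (auto simp: less_Suc_eq)
  qed (use n in auto)
  then have base: "I 0 \<sigma>0" unfolding I_def by auto
  have "I n \<sigma>'"
  proof (rule runs_For[OF run1, where I = I])
    fix i \<sigma>1 \<sigma>2
    assume i: "i < n" "I i \<sigma>1" "scal \<sigma>1 ''l'' = i" and ag1: "agree ?l \<sigma>0 \<sigma>1" and run2: "runs ?q \<sigma>1 \<sigma>2"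
    have ag1: "agree ?b \<sigma> \<sigma>1" using agree_trans[OF ag0 ag1] by simp
    have n1: "scal \<sigma>1 ''n'' = n" using agree_scal[OF ag1, of "''n''"] n by simp
    have "I i \<sigma>2 \<and> (\<forall>v<n. arr \<sigma>2 ''T'' (Suc i) v = ?R (Suc i) v)"
    proof (rule runs_For[OF run2, where I = "\<lambda>j \<tau>. I i \<tau> \<and> (\<forall>v<j. arr \<tau> ''T'' (Suc i) v = ?R (Suc i) v)"])
      fix j \<tau>1 \<tau>2
      assume j: "j < n" "I i \<tau>1 \<and> (\<forall>v<j. arr \<tau>1 ''T'' (Suc i) v = ?R (Suc i) v)" "scal \<tau>1 ''q'' = j"
        and ag2': "agree ?q \<sigma>1 \<tau>1" and run3: "runs (Seq ?copy ?p) \<tau>1 \<tau>2"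
      have ag2: "agree ?b \<sigma> \<tau>1" using agree_trans[OF ag1 ag2'] by simp
      have l2: "scal \<tau>1 ''l'' = i" using agree_scal[OF ag2', of "''l''"] i(3) by simp
      define \<tau>0 where "\<tau>0 = set_cell ''T'' (Suc i) j (arr \<tau>1 ''T'' i j) \<tau>1"
      have run4: "runs ?p \<tau>0 \<tau>2" using run3 j(3) l2 unfolding runs_Seq \<tau>0_def by simp
      have ag3: "agree ?b \<sigma> \<tau>0" using ag2 unfolding \<tau>0_def agree_def by simp
      have n3: "scal \<tau>0 ''n'' = n" using agree_scal[OF ag3, of "''n''"] n by simp
      have "I i \<tau>2 \<and> (\<forall>v<j. arr \<tau>2 ''T'' (Suc i) v = ?R (Suc i) v) \<and>
        arr \<tau>2 ''T'' (Suc i) j = of_bool (reach A i s j \<or> (\<exists>w<n. reach A i s w \<and> {w, j} \<in> A))"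
      proof (rule runs_For[OF run4, where I = "\<lambda>k \<rho>. I i \<rho> \<and> (\<forall>v<j. arr \<rho> ''T'' (Suc i) v = ?R (Suc i) v) \<and>
          arr \<rho> ''T'' (Suc i) j = of_bool (reach A i s j \<or> (\<exists>w<k. reach A i s w \<and> {w, j} \<in> A))"])
        show "I i \<tau>0 \<and> (\<forall>v<j. arr \<tau>0 ''T'' (Suc i) v = ?R (Suc i) v) \<and>
          arr \<tau>0 ''T'' (Suc i) j = of_bool (reach A i s j \<or> (\<exists>w<0. reach A i s w \<and> {w, j} \<in> A))"
          using j unfolding \<tau>0_def I_def by auto
      next
        fix k \<rho>1 \<rho>2
        assume k: "k < n" "I i \<rho>1 \<and> (\<forall>v<j. arr \<rho>1 ''T'' (Suc i) v = ?R (Suc i) v) \<and>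
          arr \<rho>1 ''T'' (Suc i) j = of_bool (reach A i s j \<or> (\<exists>w<k. reach A i s w \<and> {w, j} \<in> A))"
          "scal \<rho>1 ''p'' = k" and ag4': "agree ?p \<tau>0 \<rho>1" and run5: "runs ?scan \<rho>1 \<rho>2"
        have ag4: "agree ?b \<sigma> \<rho>1" using agree_trans[OF ag3 ag4'] by simp
        have sc: "scal \<rho>1 ''l'' = i" "scal \<rho>1 ''q'' = j"
          using agree_scal[OF ag4', of "''l''"] agree_scal[OF ag4', of "''q''"] l2 j(3)
          unfolding \<tau>0_def by auto
        have ev: "aval e \<rho>1 \<noteq> 0 \<longleftrightarrow> {k, j} \<in> A" using e[OF ag4] k(1,3) j(1) sc by simp
        have T: "arr \<rho>1 ''T'' i k = ?R i k" using k(1,2) unfolding I_def by auto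
        have "\<rho>2 = (if reach A i s k \<and> {k, j} \<in> A then set_cell ''T'' (Suc i) j 1 \<rho>1 else \<rho>1)"
          using run5 T ev sc k(3) unfolding runs_Cond by (auto split: if_splits)
        then show "I i \<rho>2 \<and> (\<forall>v<j. arr \<rho>2 ''T'' (Suc i) v = ?R (Suc i) v) \<and>
          arr \<rho>2 ''T'' (Suc i) j = of_bool (reach A i s j \<or> (\<exists>w<Suc k. reach A i s w \<and> {w, j} \<in> A))"
          using k(2) unfolding I_def by (auto simp: less_Suc_eq)
      qed (use n3 in \<open>auto simp: I_def\<close>)
      \<comment> \<open>Reachable vertices are below \<open>n\<close>, so the loop over
        \<open>p\<close> has seen every possible predecessor.\<close>
      moreover have "w < n" if "reach A i s w" for w using reach_in[OF that, of "{..<n}"] A r(2) by auto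
      then have "(\<exists>w<n. reach A i s w \<and> {w, j} \<in> A) \<longleftrightarrow> (\<exists>w. reach A i s w \<and> {w, j} \<in> A)" by blast
      ultimately show "I i \<tau>2 \<and> (\<forall>v<Suc j. arr \<tau>2 ''T'' (Suc i) v = ?R (Suc i) v)"
        by (auto simp: less_Suc_eq)
    qed (use n1 i in \<open>auto simp: I_def\<close>)
    then show "I (Suc i) \<sigma>2" unfolding I_def by (auto simp: le_Suc_eq)
  qed (use n0 base in \<open>auto simp: I_def\<close>)
  then show ?thesis using iv unfolding I_def by auto
qed

text \<open>Describing \<open>L\<close> by one function \<open>lab\<close> on unordered edges makes
  symmetry and disjointness of the spanners automatic. \<open>D\<close> holds the triples of round
  and ordered vertex pair already examined.\<close>

definition greedy_inv :: "nat \<Rightarrow> nat \<Rightarrow> nat set set \<Rightarrow> nat \<Rightarrow> (nat \<times> nat \<times> nat) set \<Rightarrow> state \<Rightarrow> bool" where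
  "greedy_inv n f E t D \<sigma> \<longleftrightarrow> scal \<sigma> ''n'' = n \<and> scal \<sigma> ''t'' = t \<and> arr \<sigma> ''G'' = adj_matrix E \<and>
    (\<exists>lab. arr \<sigma> ''L'' = (\<lambda>x y. lab {x, y}) \<and> arr \<sigma> ''H'' = adj_matrix {e. lab e \<noteq> 0} \<and>
      (\<forall>e. lab e \<noteq> 0 \<longrightarrow> e \<in> E \<and> lab e \<le> Suc f) \<and> (\<forall>i. girth_above t {e. lab e = Suc i}) \<and>
      (\<forall>(i, u, v)\<in>D. {u, v} \<in> E \<longrightarrow> lab {u, v} \<noteq> 0 \<or> reach {e. lab e = Suc i} t u v))"

text \<open>An edge is stored only when row \<open>t\<close> of the table, available because
  \<open>t\<close> is at most \<open>n\<close>, shows no bypass; then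
  \<open>girth_above_insert\<close> applies. Otherwise it is labelled already or has a bypass, which
  later insertions preserve.\<close>

lemma greedy_step_correct:
  assumes E: "simple_graph {..<n} E" and t: "t \<le> n" and inv: "greedy_inv n f E t D \<sigma>"
    and ix: "scal \<sigma> ''i'' = i" "scal \<sigma> ''u'' = u" "scal \<sigma> ''v'' = v" "i \<le> f" "u < n" "v < n"
    and run: "runs greedy_step \<sigma> \<sigma>'"
  shows "greedy_inv n f E t (insert (i, u, v) D) \<sigma>'"
proof -
  obtain lab where sc: "scal \<sigma> ''n'' = n" "scal \<sigma> ''t'' = t" "arr \<sigma> ''G'' = adj_matrix E"
    and lab: "arr \<sigma> ''L'' = (\<lambda>x y. lab {x, y})" "arr \<sigma> ''H'' = adj_matrix {e. lab e \<noteq> 0}"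
      "\<And>e. lab e \<noteq> 0 \<Longrightarrow> e \<in> E \<and> lab e \<le> Suc f" "\<And>i. girth_above t {e. lab e = Suc i}"
      "\<And>i u v. (i, u, v) \<in> D \<Longrightarrow> {u, v} \<in> E \<Longrightarrow> lab {u, v} \<noteq> 0 \<or> reach {e. lab e = Suc i} t u v"
    using inv unfolding greedy_inv_def by blast
  let ?e = "eqv (Cell ''L'' (Var ''p'') (Var ''q'')) (Plus (Var ''i'') (Num 1))"
  let ?S = "{e. lab e = Suc i}"
  from run obtain \<sigma>1 where run1: "runs (bfs ''u'' ?e) \<sigma> \<sigma>1" and
    run2: "runs (Cond (Cell ''G'' (Var ''u'') (Var ''v'')) (Cond (Cell ''L'' (Var ''u'') (Var ''v'')) Skip
       (Cond (Cell ''T'' (Var ''t'') (Var ''v'')) Skip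
         (Seq (Store ''L'' (Var ''u'') (Var ''v'') (Plus (Var ''i'') (Num 1)))
         (Seq (Store ''L'' (Var ''v'') (Var ''u'') (Plus (Var ''i'') (Num 1)))
         (Seq (Store ''H'' (Var ''u'') (Var ''v'') (Num 1))
              (Store ''H'' (Var ''v'') (Var ''u'') (Num 1))))))) Skip) \<sigma>1 \<sigma>'"
    unfolding greedy_step_def by (rule runs_SeqE)
  have ag: "agree (bfs ''u'' ?e) \<sigma> \<sigma>1" using run1 by (rule runs_agree)
  have sc1: "scal \<sigma>1 ''n'' = n" "scal \<sigma>1 ''t'' = t" "scal \<sigma>1 ''i'' = i" "scal \<sigma>1 ''u'' = u" "scal \<sigma>1 ''v'' = v"
    using ag sc ix unfolding agree_def by auto
  have ar1: "arr \<sigma>1 ''G'' = adj_matrix E" "arr \<sigma>1 ''L'' = (\<lambda>x y. lab {x, y})"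
    "arr \<sigma>1 ''H'' = adj_matrix {e. lab e \<noteq> 0}"
    using ag sc lab unfolding agree_def by auto
  have T: "arr \<sigma>1 ''T'' t v = of_bool (reach ?S t u v)"
  proof (rule bfs_correct[OF run1 sc(1) ix(2,5) _ _ _ t ix(6)])
    fix \<sigma>2 assume "agree (bfs ''u'' ?e) \<sigma> \<sigma>2"
    then have "scal \<sigma>2 ''i'' = i" "arr \<sigma>2 ''L'' = (\<lambda>x y. lab {x, y})"
      using ix lab(1) unfolding agree_def by auto
    then show "aval ?e \<sigma>2 \<noteq> 0 \<longleftrightarrow> {scal \<sigma>2 ''p'', scal \<sigma>2 ''q''} \<in> ?S" by simp
  next
    fix e assume "e \<in> ?S"
    then show "e \<subseteq> {..<n}" using lab(3)[of e] E unfolding simple_graph_def by auto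
  qed simp
  show ?thesis
  proof (cases "{u, v} \<in> E \<and> lab {u, v} = 0 \<and> \<not> reach ?S t u v")
    case False
    have "\<sigma>' = \<sigma>1"
      using False run2 ar1 sc1 T unfolding runs_Cond by (auto simp: adj_matrix_def split: if_splits)
    moreover have "lab {x, y} \<noteq> 0 \<or> reach {e. lab e = Suc j} t x y"
      if "(j, x, y) \<in> insert (i, u, v) D" "{x, y} \<in> E" for j x y
      using that lab(5)[of j x y] False by (cases "(j, x, y) = (i, u, v)") auto
    ultimately show ?thesis using sc1 ar1 lab(3,4) unfolding greedy_inv_def
      by (intro conjI exI[of _ lab]) blast+
  next
    case True
    then have ne: "u \<noteq> v" by auto
    define lab' where "lab' = lab({u, v} := Suc i)"
    have \<sigma>': "\<sigma>' = set_cell ''H'' v u 1 (set_cell ''H'' u v 1 (set_cell ''L'' v u (Suc i) (set_cell ''L'' u v (Suc i) \<sigma>1)))"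
      using run2 ar1 sc1 T True unfolding runs_Cond runs_Seq by (simp add: adj_matrix_def)
    have "arr \<sigma>' ''L'' = (\<lambda>x y. lab' {x, y})"
      unfolding \<sigma>' lab'_def using ar1 ne by (auto simp: fun_eq_iff doubleton_eq_iff)
    moreover have "arr \<sigma>' ''H'' = adj_matrix {e. lab' e \<noteq> 0}"
      unfolding \<sigma>' lab'_def using ar1 ne by (auto simp: fun_eq_iff doubleton_eq_iff adj_matrix_def)
    moreover have "arr \<sigma>' ''G'' = adj_matrix E" "scal \<sigma>' ''n'' = n" "scal \<sigma>' ''t'' = t"
      unfolding \<sigma>' using ar1 sc1 by auto
    moreover have "e \<in> E \<and> lab' e \<le> Suc f" if "lab' e \<noteq> 0" for e
      using that lab(3)[of e] True ix(4) unfolding lab'_def by (auto split: if_splits)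
    moreover have S: "{e. lab' e = Suc j} = (if j = i then insert {u, v} ?S else {e. lab e = Suc j})" for j
      unfolding lab'_def using True by auto
    moreover have "girth_above t {e. lab' e = Suc j}" for j
      using girth_above_insert[OF lab(4), of i u v] lab(4)[of j] True unfolding S by simp
    moreover have "lab' {x, y} \<noteq> 0 \<or> reach {e. lab' e = Suc j} t x y"
      if "(j, x, y) \<in> insert (i, u, v) D" "{x, y} \<in> E" for j x y
    proof (cases "(j, x, y) = (i, u, v)")
      case False
      then have "lab {x, y} \<noteq> 0 \<or> reach {e. lab e = Suc j} t x y" using lab(5) that by auto
      moreover have "{e. lab e = Suc j} \<subseteq> {e. lab' e = Suc j}" unfolding S by auto
      ultimately show ?thesis using reach_mono unfolding lab'_def by (metis fun_upd_apply nat.distinct(1))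
    qed (simp add: lab'_def)
    ultimately show ?thesis unfolding greedy_inv_def by (intro conjI exI[of _ lab']) blast+
  qed
qed

lemma greedy_inv_set_scal:
  "x \<notin> {''n'', ''t''} \<Longrightarrow> greedy_inv n f E t D \<sigma> \<Longrightarrow> greedy_inv n f E t D (set_scal x m \<sigma>)"
  unfolding greedy_inv_def by auto

lemma greedy_inv_bound: "greedy_inv n f E t D \<sigma> \<Longrightarrow> aval (Var ''n'') \<sigma> = n"
  unfolding greedy_inv_def by auto

lemma spanners_correct:
  assumes E: "simple_graph {..<n} E" and t: "t \<le> n" and inv: "greedy_inv n f E t {} \<sigma>"
    and run: "runs (spanners f) \<sigma> \<sigma>'"
  shows "greedy_inv n f E t ({..f} \<times> {..<n} \<times> {..<n}) \<sigma>'"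
proof -
  let ?v = "For ''v'' (Var ''n'') greedy_step"
  let ?u = "For ''u'' (Var ''n'') ?v"
  let ?inv = "greedy_inv n f E t"
  have "?inv ({..<Suc f} \<times> {..<n} \<times> {..<n}) \<sigma>'"
  proof (rule runs_For[OF run[unfolded spanners_def], where I = "\<lambda>i. ?inv ({..<i} \<times> {..<n} \<times> {..<n})"])
    fix i \<sigma>1 \<sigma>2
    assume i: "i < Suc f" "?inv ({..<i} \<times> {..<n} \<times> {..<n}) \<sigma>1" "scal \<sigma>1 ''i'' = i" "runs ?u \<sigma>1 \<sigma>2"
    let ?D = "\<lambda>u. {..<i} \<times> {..<n} \<times> {..<n} \<union> {i} \<times> {..<u} \<times> {..<n}"
    have "?inv (?D n) \<sigma>2"
    proof (rule runs_For[OF i(4), where I = "\<lambda>u. ?inv (?D u)"])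
      fix u \<tau>1 \<tau>2
      assume u: "u < n" "?inv (?D u) \<tau>1" "scal \<tau>1 ''u'' = u" "agree ?u \<sigma>1 \<tau>1" "runs ?v \<tau>1 \<tau>2"
      have "scal \<tau>1 ''i'' = i" using agree_scal[OF u(4), of "''i''"] i by simp
      have "?inv (?D u \<union> {i} \<times> {u} \<times> {..<n}) \<tau>2"
      proof (rule runs_For[OF u(5), where I = "\<lambda>v. ?inv (?D u \<union> {i} \<times> {u} \<times> {..<v})"])
        fix v \<rho>1 \<rho>2
        assume v: "v < n" "?inv (?D u \<union> {i} \<times> {u} \<times> {..<v}) \<rho>1" "scal \<rho>1 ''v'' = v" "agree ?v \<tau>1 \<rho>1"
          "runs greedy_step \<rho>1 \<rho>2"
        have sc: "scal \<rho>1 ''i'' = i" "scal \<rho>1 ''u'' = u"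
          using agree_scal[OF v(4), of "''i''"] agree_scal[OF v(4), of "''u''"] u(3) \<open>scal \<tau>1 ''i'' = i\<close> by auto
        have "?inv (insert (i, u, v) (?D u \<union> {i} \<times> {u} \<times> {..<v})) \<rho>2"
          using greedy_step_correct[OF E t v(2) sc v(3) _ u(1) v(1,5)] i(1) by simp
        moreover have "insert (i, u, v) (?D u \<union> {i} \<times> {u} \<times> {..<v}) = ?D u \<union> {i} \<times> {u} \<times> {..<Suc v}" by auto
        ultimately show "?inv (?D u \<union> {i} \<times> {u} \<times> {..<Suc v}) \<rho>2" by simp
      qed (use u greedy_inv_bound in \<open>auto intro: greedy_inv_set_scal\<close>)
      moreover have "?D u \<union> {i} \<times> {u} \<times> {..<n} = ?D (Suc u)" by auto
      ultimately show "?inv (?D (Suc u)) \<tau>2" by simp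
    qed (use i greedy_inv_bound in \<open>auto intro: greedy_inv_set_scal\<close>)
    moreover have "?D n = {..<Suc i} \<times> {..<n} \<times> {..<n}" by auto
    ultimately show "?inv ({..<Suc i} \<times> {..<n} \<times> {..<n}) \<sigma>2" by simp
  qed (use inv in \<open>auto intro: greedy_inv_set_scal\<close>)
  then show ?thesis by (simp add: lessThan_Suc_atMost)
qed

subsection \<open>Correctness of the last-edge phases\<close>

text \<open>An edge \<open>e\<close> added at \<open>v\<close> on behalf of the fault set \<open>F\<close>, with the path \<open>P\<close> that it ends.\<close>

definition log_entry :: "'a set set \<Rightarrow> 'a \<Rightarrow> 'a set \<Rightarrow> nat \<Rightarrow> nat \<Rightarrow> nat \<Rightarrow>
    'a \<Rightarrow> 'a set \<Rightarrow> 'a set set \<Rightarrow> 'a set set \<Rightarrow> bool" where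
  "log_entry E s V K m d v e P F \<longleftrightarrow> v \<in> V \<and> e \<in> E \<and> finite P \<and> card P \<le> K \<and>
     finite F \<and> card F \<le> m \<and> P \<inter> F = {} \<and>
     (\<forall>B. P \<inter> B = {} \<longrightarrow> (\<exists>w. reach (E - B) d s w \<and> e = {w, v} \<and> e \<notin> B))"

text \<open>The edges added to \<open>h0\<close>, numbered in order of insertion. For each endpoint
  \<open>v\<close> separately, the stored paths and fault sets satisfy the hypotheses of
  \<open>skew_set_pairs\<close>.\<close>

definition edge_log :: "'a set set \<Rightarrow> 'a \<Rightarrow> 'a set \<Rightarrow> nat \<Rightarrow> nat \<Rightarrow> nat \<Rightarrow> 'a set set \<Rightarrow> 'a set set \<Rightarrow> bool" where
  "edge_log E s V K m d h0 h \<longleftrightarrow> (\<exists>(N::nat) v e P F. h = h0 \<union> e ` {..<N} \<and>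
    (\<forall>i<N. log_entry E s V K m d (v i) (e i) (P i) (F i)) \<and>
    (\<forall>i j. i < j \<longrightarrow> j < N \<longrightarrow> v i = v j \<longrightarrow> P i \<inter> F j \<noteq> {}))"

lemma edge_logI:
  assumes "h = h0 \<union> e ` {..<N::nat}" "\<And>i. i < N \<Longrightarrow> log_entry E s V K m d (v i) (e i) (P i) (F i)"
    "\<And>i j. i < j \<Longrightarrow> j < N \<Longrightarrow> v i = v j \<Longrightarrow> P i \<inter> F j \<noteq> {}"
  shows "edge_log E s V K m d h0 h"
  unfolding edge_log_def using assms
  by (intro exI[of _ N] exI[of _ v] exI[of _ e] exI[of _ P] exI[of _ F]) simp

lemma edge_logE:
  assumes "edge_log E s V K m d h0 h"
  obtains N :: nat and v e P F where "h = h0 \<union> e ` {..<N}"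
    "\<And>i. i < N \<Longrightarrow> log_entry E s V K m d (v i) (e i) (P i) (F i)"
    "\<And>i j. i < j \<Longrightarrow> j < N \<Longrightarrow> v i = v j \<Longrightarrow> P i \<inter> F j \<noteq> {}"
proof -
  from assms obtain N :: nat and v e P F where "h = h0 \<union> e ` {..<N}"
    "\<forall>i<N. log_entry E s V K m d (v i) (e i) (P i) (F i)"
    "\<forall>i j. i < j \<longrightarrow> j < N \<longrightarrow> v i = v j \<longrightarrow> P i \<inter> F j \<noteq> {}"
    unfolding edge_log_def by blast
  then show thesis using that[of e N v P F] by simp
qed

text \<open>Since \<open>reach\<close> bounds lengths from above, entries for small distances stay
  valid for larger ones. One log therefore serves all distances in increasing order, and the count
  gains no factor for their number.\<close>

lemma log_entry_Suc: "log_entry E s V K m d v e P F \<Longrightarrow> log_entry E s V K m (Suc d) v e P F"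
  unfolding log_entry_def reach.simps by blast

lemma edge_log_refl: "edge_log E s V K m d h h"
  by (rule edge_logI[where N = 0]) auto

lemma edge_log_Suc: "edge_log E s V K m d h0 h \<Longrightarrow> edge_log E s V K m (Suc d) h0 h"
  by (elim edge_logE, rule edge_logI) (auto intro: log_entry_Suc)

lemma edge_log_subset: "edge_log E s V K m d h0 h \<Longrightarrow> h0 \<subseteq> h \<and> h \<subseteq> h0 \<union> E"
  unfolding edge_log_def log_entry_def by auto

text \<open>\<open>skew_set_pairs\<close> is applied to the entries at each vertex. For
  \<open>m = 0\<close> it allows one edge per vertex, as in a BFS tree.\<close>

lemma edge_log_card:
  assumes L: "edge_log E s V K m d h0 h" and "finite V" "finite h0"
  shows "finite h \<and> card h \<le> card h0 + card V * (\<Sum>i\<le>m. K ^ i)"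
proof -
  obtain N :: nat and v e P F where L: "h = h0 \<union> e ` {..<N}"
    "\<And>i. i < N \<Longrightarrow> log_entry E s V K m d (v i) (e i) (P i) (F i)"
    "\<And>i j. i < j \<Longrightarrow> j < N \<Longrightarrow> v i = v j \<Longrightarrow> P i \<inter> F j \<noteq> {}"
    using L by (rule edge_logE) (rule that)
  have "card {i. i < N \<and> v i = x} \<le> (\<Sum>i\<le>m. K ^ i)" for x
    by (rule skew_set_pairs[where P = P and F = F]) (use L(2,3) in \<open>auto simp: log_entry_def\<close>)
  then have "(\<Sum>x\<in>V. card {i. i < N \<and> v i = x}) \<le> card V * (\<Sum>i\<le>m. K ^ i)"
    using sum_bounded_above[of V "\<lambda>x. card {i. i < N \<and> v i = x}"] by simp
  moreover have "{..<N} \<subseteq> (\<Union>x\<in>V. {i. i < N \<and> v i = x})" using L(2) by (auto simp: log_entry_def)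
  then have "card {..<N} \<le> card (\<Union>x\<in>V. {i. i < N \<and> v i = x})"
    using \<open>finite V\<close> by (intro card_mono) auto
  then have "N \<le> (\<Sum>x\<in>V. card {i. i < N \<and> v i = x})"
    using card_UN_le[OF \<open>finite V\<close>, of "\<lambda>x. {i. i < N \<and> v i = x}"] by simp
  moreover have "card h \<le> card h0 + card (e ` {..<N})" unfolding L(1) by (rule card_Un_le)
  moreover have "card (e ` {..<N}) \<le> N" using card_image_le[of "{..<N}" e] by simp
  ultimately show ?thesis using L(1) \<open>finite h0\<close> by simp
qed

text \<open>If the path stored with an earlier edge at \<open>v\<close> avoided \<open>B\<close>, that edge would already be a
  suitable last edge; so every earlier path at \<open>v\<close> meets \<open>B\<close>.\<close>

lemma edge_log_insert:
  assumes L: "edge_log E s V K m d h0 h" and v: "v \<in> V" and B: "finite B" "card B \<le> m"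
    and d: "d < K" and w: "reach (E - B) d s w" "{w, v} \<in> E - B"
    and pref: "\<And>w'. reach (E - B) d s w' \<Longrightarrow> {w', v} \<in> (E - B) \<inter> h \<Longrightarrow> {w, v} \<in> h"
  shows "edge_log E s V K m d h0 (insert {w, v} h)"
proof (cases "{w, v} \<in> h")
  case True
  then show ?thesis using L by (simp add: insert_absorb)
next
  case False
  obtain N :: nat and u e P F where L: "h = h0 \<union> e ` {..<N}"
    "\<And>i. i < N \<Longrightarrow> log_entry E s V K m d (u i) (e i) (P i) (F i)"
    "\<And>i j. i < j \<Longrightarrow> j < N \<Longrightarrow> u i = u j \<Longrightarrow> P i \<inter> F j \<noteq> {}"
    using L by (rule edge_logE) (rule that)
  obtain Q where Q: "Q \<subseteq> E - B" "finite Q" "card Q \<le> d" "reach Q d s w"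
    using reach_edges[OF w(1)] by blast
  have new: "log_entry E s V K m d v {w, v} (insert {w, v} Q) B"
    unfolding log_entry_def
  proof (intro conjI allI impI)
    \<comment> \<open>At most \<open>d\<close> edges up to \<open>w\<close>, plus the last one, with
      \<open>d < K\<close>.\<close>
    show "card (insert {w, v} Q) \<le> K" using Q d by (simp add: card_insert_if)
    fix B' assume B': "insert {w, v} Q \<inter> B' = {}"
    then have "Q \<subseteq> E - B'" using Q(1) by auto
    then have "reach (E - B') d s w" by (rule reach_mono[OF Q(4)])
    then show "\<exists>w'. reach (E - B') d s w' \<and> {w, v} = {w', v} \<and> {w, v} \<notin> B'"
      using B' by (intro exI[of _ w]) simp
  qed (use v w B Q in auto)
  show ?thesis
  proof (rule edge_logI[where N = "Suc N" and v = "u(N := v)" and e = "e(N := {w, v})" and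
        P = "P(N := insert {w, v} Q)" and F = "F(N := B)"])
    show "insert {w, v} h = h0 \<union> (e(N := {w, v})) ` {..<Suc N}"
      unfolding L(1) by (auto simp: lessThan_Suc)
  next
    fix i assume "i < Suc N"
    then show "log_entry E s V K m d ((u(N := v)) i) ((e(N := {w, v})) i)
        ((P(N := insert {w, v} Q)) i) ((F(N := B)) i)"
      using L(2)[of i] new by (cases "i = N") auto
  next
    fix i j assume ij: "i < j" "j < Suc N" "(u(N := v)) i = (u(N := v)) j"
    show "(P(N := insert {w, v} Q)) i \<inter> (F(N := B)) j \<noteq> {}"
    proof (cases "j = N")
      case True
      then have i: "i < N" "u i = v" using ij by (auto split: if_splits)
      have "P i \<inter> B \<noteq> {}"
      proof
        assume "P i \<inter> B = {}"
        then obtain w' where "reach (E - B) d s w'" "e i = {w', v}" "e i \<notin> B" "e i \<in> E"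
          using L(2)[OF i(1)] i(2) unfolding log_entry_def by blast
        then show False using pref[of w'] False L(1) i(1) by auto
      qed
      then show ?thesis using True i by auto
    next
      case False
      then show ?thesis using ij L(3)[of i j] by auto
    qed
  qed
qed

text \<open>\<open>D\<close> holds the pairs of distance and deleted set already treated;
  \<open>h0\<close> is the output graph at the start of the phase.\<close>

definition last_inv :: "nat \<Rightarrow> nat \<Rightarrow> nat set set \<Rightarrow> nat \<Rightarrow> nat \<Rightarrow> nat set set \<Rightarrow> nat \<Rightarrow>
    (nat \<times> nat set set) set \<Rightarrow> state \<Rightarrow> bool" where
  "last_inv n s E K m h0 d D \<sigma> \<longleftrightarrow> scal \<sigma> ''n'' = n \<and> scal \<sigma> ''s'' = s \<and> arr \<sigma> ''G'' = adj_matrix E \<and>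
    (\<exists>h. arr \<sigma> ''H'' = adj_matrix h \<and> edge_log E s {..<n} K m d h0 h \<and>
      (\<forall>(d', B)\<in>D. last_edges (E - B) s d' {..<n} h))"

text \<open>The first candidate is taken unconditionally, and later ones only if their edge is in
  \<open>h\<close>. The resulting preference for existing edges is the hypothesis
  \<open>pref\<close> of \<open>edge_log_insert\<close>.\<close>

lemma scan_correct:
  assumes run: "runs (For ''w'' (Var ''n'') scan) \<sigma> \<sigma>'" and "scal \<sigma> ''n'' = n" "scal \<sigma> ''c'' = 0"
    and cand: "\<And>w. w < n \<Longrightarrow> cand w \<longleftrightarrow> arr \<sigma> ''T'' (scal \<sigma> ''d'') w \<noteq> 0 \<and> aval (adjX ''w'' ''v'') (set_scal ''w'' w \<sigma>) \<noteq> 0"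
    and h: "arr \<sigma> ''H'' = adj_matrix h" and v: "scal \<sigma> ''v'' = v" and ex: "\<exists>w<n. cand w"
  shows "\<exists>w<n. scal \<sigma>' ''c'' = Suc w \<and> cand w \<and> ((\<exists>w'<n. cand w' \<and> {w', v} \<in> h) \<longrightarrow> {w, v} \<in> h)"
proof -
  define I where "I k \<tau> \<longleftrightarrow> scal \<tau> ''c'' = 0 \<and> (\<forall>w<k. \<not> cand w) \<or>
    (\<exists>w<k. scal \<tau> ''c'' = Suc w \<and> cand w \<and> ((\<exists>w'<k. cand w' \<and> {w', v} \<in> h) \<longrightarrow> {w, v} \<in> h))"
    for k and \<tau> :: state
  have "I n \<sigma>'"
  proof (rule runs_For[OF run, where I = I])
    fix k \<tau>1 \<tau>2
    assume k: "k < n" "I k \<tau>1" "scal \<tau>1 ''w'' = k" and ag: "agree (For ''w'' (Var ''n'') scan) \<sigma> \<tau>1"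
      and r: "runs scan \<tau>1 \<tau>2"
    have sc: "scal \<tau>1 ''d'' = scal \<sigma> ''d''" "scal \<tau>1 ''v'' = v" "arr \<tau>1 = arr \<sigma>"
      using ag v unfolding agree_def scan_def by auto
    have "cand k \<longleftrightarrow> arr \<tau>1 ''T'' (scal \<tau>1 ''d'') (scal \<tau>1 ''w'') \<noteq> 0 \<and> aval (adjX ''w'' ''v'') \<tau>1 \<noteq> 0"
      using cand[OF k(1)] sc k(3) v by (simp add: adjX_def)
    then have \<tau>2: "\<tau>2 = (if cand k \<and> (scal \<tau>1 ''c'' = 0 \<or> {k, v} \<in> h) then set_scal ''c'' (Suc k) \<tau>1 else \<tau>1)"
      using r sc k(3) h unfolding scan_def runs_Cond by (auto simp: adj_matrix_def split: if_splits)
    show "I (Suc k) \<tau>2"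
    proof (cases "cand k \<and> (scal \<tau>1 ''c'' = 0 \<or> {k, v} \<in> h)")
      case True
      then have "{k, v} \<in> h" if "w' < Suc k" "cand w'" "{w', v} \<in> h" for w'
        using that k(2) unfolding I_def by (auto simp: less_Suc_eq)
      then show ?thesis using True unfolding \<tau>2 I_def by (intro disjI2 exI[of _ k]) auto
    next
      case False
      then show ?thesis using k(2) unfolding \<tau>2 I_def by (auto simp: less_Suc_eq)
    qed
  qed (use assms in \<open>auto simp: I_def scan_def\<close>)
  then show ?thesis using ex unfolding I_def by auto
qed

lemma add_last_edges_correct:
  assumes E: "simple_graph {..<n} E" and s: "s < n" and inv: "last_inv n s E K m h0 d D \<sigma>"
    and d: "scal \<sigma> ''d'' = d" "d < n" "d < K"
    and X: "arr \<sigma> ''X'' = (\<lambda>x y. cnt {x, y})" and B: "B = {e. cnt e \<noteq> 0}" "finite B" "card B \<le> m"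
    and run: "runs add_last_edges \<sigma> \<sigma>'"
  shows "last_inv n s E K m h0 d (insert (d, B) D) \<sigma>'"
proof -
  let ?c = "Cond (Minus (Cell ''T'' (Plus (Var ''d'') (Num 1)) (Var ''v'')) (Cell ''T'' (Var ''d'') (Var ''v''))) pick Skip"
  let ?for = "For ''v'' (Var ''n'') ?c"
  have sc: "scal \<sigma> ''n'' = n" "scal \<sigma> ''s'' = s" "arr \<sigma> ''G'' = adj_matrix E"
    using inv unfolding last_inv_def by auto
  from run obtain \<sigma>1 where run1: "runs (bfs ''s'' (adjX ''p'' ''q'')) \<sigma> \<sigma>1" and run2: "runs ?for \<sigma>1 \<sigma>'"
    unfolding add_last_edges_def by (rule runs_SeqE)
  have ag1: "agree (bfs ''s'' (adjX ''p'' ''q'')) \<sigma> \<sigma>1" using run1 by (rule runs_agree)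
  have adj: "aval (adjX p q) \<tau> \<noteq> 0 \<longleftrightarrow> {scal \<tau> p, scal \<tau> q} \<in> E - B"
    if "arr \<tau> ''X'' = arr \<sigma> ''X''" "arr \<tau> ''G'' = arr \<sigma> ''G''" for p q \<tau>
    using that sc(3) X B(1) by (auto simp: adjX_def adj_matrix_def)
  have EV: "e \<subseteq> {..<n}" if "e \<in> E - B" for e using that E unfolding simple_graph_def by auto
  have T: "arr \<sigma>1 ''T'' i v = of_bool (reach (E - B) i s v)" if "i \<le> n" "v < n" for i v
  proof (rule bfs_correct[OF run1 sc(1,2) s _ _ EV that])
    fix \<tau> assume "agree (bfs ''s'' (adjX ''p'' ''q'')) \<sigma> \<tau>"
    then show "aval (adjX ''p'' ''q'') \<tau> \<noteq> 0 \<longleftrightarrow> {scal \<tau> ''p'', scal \<tau> ''q''} \<in> E - B"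
      by (intro adj) (auto simp: agree_def)
  qed simp
  define I where "I j \<tau> \<longleftrightarrow> scal \<tau> ''n'' = n \<and> scal \<tau> ''s'' = s \<and> arr \<tau> ''G'' = adj_matrix E \<and>
    (\<exists>h. arr \<tau> ''H'' = adj_matrix h \<and> edge_log E s {..<n} K m d h0 h \<and>
      (\<forall>(d', B)\<in>D. last_edges (E - B) s d' {..<n} h) \<and> last_edges (E - B) s d {..<j} h)" for j and \<tau> :: state
  have "I n \<sigma>'"
  proof (rule runs_For[OF run2, where I = I])
    have "arr \<sigma>1 ''H'' = arr \<sigma> ''H''" "arr \<sigma>1 ''G'' = arr \<sigma> ''G''" "scal \<sigma>1 ''n'' = n" "scal \<sigma>1 ''s'' = s"
      using ag1 sc unfolding agree_def by auto
    then show "I 0 \<sigma>1" using inv unfolding I_def last_inv_def by (auto simp: last_edges_def)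
    show "aval (Var ''n'') \<sigma>1 = n" using \<open>scal \<sigma>1 ''n'' = n\<close> by simp
  next
    fix v \<tau>1 \<tau>2
    assume v: "v < n" "I v \<tau>1" "scal \<tau>1 ''v'' = v" and ag2: "agree ?for \<sigma>1 \<tau>1" and r: "runs ?c \<tau>1 \<tau>2"
    obtain h where h: "scal \<tau>1 ''n'' = n" "scal \<tau>1 ''s'' = s" "arr \<tau>1 ''G'' = adj_matrix E"
      "arr \<tau>1 ''H'' = adj_matrix h" "edge_log E s {..<n} K m d h0 h"
      "\<And>d' B. (d', B) \<in> D \<Longrightarrow> last_edges (E - B) s d' {..<n} h" "last_edges (E - B) s d {..<v} h"
      using v(2) unfolding I_def by auto
    have sc1: "scal \<tau>1 ''d'' = d" "arr \<tau>1 ''T'' = arr \<sigma>1 ''T''" "arr \<tau>1 ''X'' = arr \<sigma> ''X''"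
      using ag1 ag2 d unfolding agree_def by (auto simp: pick_def scan_def)
    show "I (Suc v) \<tau>2"
    \<comment> \<open>Row \<open>Suc d\<close> is among the computed rows because
      \<open>d < n\<close>.\<close>
    proof (cases "reach (E - B) (Suc d) s v \<and> \<not> reach (E - B) d s v")
      case False
      then have "\<tau>2 = \<tau>1"
        using r sc1 v T[of d v] T[of "Suc d" v] d(2) unfolding runs_Cond by (auto split: if_splits)
      moreover have "last_edges (E - B) s d {..<Suc v} h"
        using h(7) False unfolding last_edges_def by (auto simp: less_Suc_eq simp del: reach.simps)
      ultimately show ?thesis using h unfolding I_def by blast
    next
      case True
      then have "runs pick \<tau>1 \<tau>2"
        using r sc1 v T[of d v] T[of "Suc d" v] d(2) unfolding runs_Cond by (auto split: if_splits)
      then obtain \<tau>3 where run3: "runs (For ''w'' (Var ''n'') scan) (set_scal ''c'' 0 \<tau>1) \<tau>3"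
        and \<tau>2: "\<tau>2 = set_cell ''H'' (scal \<tau>3 ''v'') (scal \<tau>3 ''c'' - 1) 1
          (set_cell ''H'' (scal \<tau>3 ''c'' - 1) (scal \<tau>3 ''v'') 1 \<tau>3)"
        unfolding pick_def runs_Seq by auto
      have ag3: "agree (For ''w'' (Var ''n'') scan) (set_scal ''c'' 0 \<tau>1) \<tau>3" using run3 by (rule runs_agree)
      define cand where "cand w \<longleftrightarrow> reach (E - B) d s w \<and> {w, v} \<in> E - B" for w
      have "\<exists>w<n. cand w"
      proof -
        obtain w where w: "reach (E - B) d s w" "{w, v} \<in> E - B" using True by auto
        then show ?thesis using reach_in[OF w(1), of "{..<n}"] EV s unfolding cand_def by auto
      qed
      then have "\<exists>w<n. scal \<tau>3 ''c'' = Suc w \<and> cand w \<and> ((\<exists>w'<n. cand w' \<and> {w', v} \<in> h) \<longrightarrow> {w, v} \<in> h)"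
      proof (rule scan_correct[OF run3, rotated -1])
        fix w assume "w < n"
        then show "cand w \<longleftrightarrow> arr (set_scal ''c'' 0 \<tau>1) ''T'' (scal (set_scal ''c'' 0 \<tau>1) ''d'') w \<noteq> 0 \<and>
          aval (adjX ''w'' ''v'') (set_scal ''w'' w (set_scal ''c'' 0 \<tau>1)) \<noteq> 0"
          using adj[of "set_scal ''w'' w (set_scal ''c'' 0 \<tau>1)" "''w''" "''v''"] sc1 h(3) sc(3) v(3) T[of d w] d(2)
          unfolding cand_def by simp
      qed (use h v in auto)
      then obtain w where w: "w < n" "scal \<tau>3 ''c'' = Suc w" "cand w" "\<And>w'. w' < n \<Longrightarrow> cand w' \<Longrightarrow> {w', v} \<in> h \<Longrightarrow> {w, v} \<in> h"
        by blast
      let ?h = "insert {w, v} h"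
      have sc3: "scal \<tau>3 ''v'' = v" "arr \<tau>3 ''H'' = adj_matrix h" "arr \<tau>3 ''G'' = adj_matrix E"
        "scal \<tau>3 ''n'' = n" "scal \<tau>3 ''s'' = s"
        using ag3 v h unfolding agree_def by (auto simp: scan_def)
      have "arr \<tau>2 ''H'' = adj_matrix ?h"
        unfolding \<tau>2 using sc3 w(2) by (auto simp: adj_matrix_def fun_eq_iff doubleton_eq_iff)
      moreover have "edge_log E s {..<n} K m d h0 ?h"
      proof (rule edge_log_insert[OF h(5) _ B(2,3) d(3)])
        fix w' assume w': "reach (E - B) d s w'" "{w', v} \<in> (E - B) \<inter> h"
        then have "w' < n" using EV by auto
        then show "{w, v} \<in> h" using w(4)[of w'] w' unfolding cand_def by blast
      qed (use w(3) v(1) in \<open>auto simp: cand_def\<close>)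
      moreover have "last_edges (E - B) s d {..<Suc v} ?h"
        using h(7) w(3) unfolding last_edges_def cand_def by (auto simp: less_Suc_eq simp del: reach.simps) blast+
      moreover have "last_edges (E - B) s d' {..<n} ?h" if "(d', B) \<in> D" for d' B
        using last_edges_mono[OF h(6)[OF that]] by blast
      moreover have "arr \<tau>2 ''G'' = adj_matrix E" "scal \<tau>2 ''n'' = n" "scal \<tau>2 ''s'' = s"
        unfolding \<tau>2 using sc3 by auto
      ultimately show ?thesis unfolding I_def by blast
    qed
  qed (auto simp: pick_def scan_def I_def)
  then show ?thesis unfolding I_def last_inv_def by auto
qed

section \<open>Enumeration of the fault sets\<close>

primrec pair_sets :: "nat \<Rightarrow> nat \<Rightarrow> nat set set set" where
  "pair_sets n 0 = {{}}"
| "pair_sets n (Suc m) = (\<Union>x<n. \<Union>y<n. insert {x, y} ` pair_sets n m)"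

text \<open>It suffices to produce every graph \<open>E - F\<close>. Fault sets with fewer than
  \<open>m\<close> edges are padded with the singleton \<open>{0, 0}\<close>, which is no
  edge.\<close>

lemma pair_sets_cover:
  assumes E: "simple_graph {..<n} E" and n: "0 < n"
  shows "F \<subseteq> E \<Longrightarrow> finite F \<Longrightarrow> card F \<le> m \<Longrightarrow> \<exists>B\<in>pair_sets n m. E - B = E - F"
proof (induction m arbitrary: F)
  case (Suc m)
  show ?case
  proof (cases "F = {}")
    case True
    then obtain B where B: "B \<in> pair_sets n m" "E - B = E - F" using Suc.IH[of F] by auto
    have "{0, 0} \<notin> E" using E unfolding simple_graph_def by auto
    then have "E - insert {0, 0} B = E - F" using B(2) by auto
    moreover have "insert {0, 0} B \<in> pair_sets n (Suc m)"
      unfolding pair_sets.simps using B(1) n by blast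
    ultimately show ?thesis by blast
  next
    case False
    then obtain e where e: "e \<in> F" by blast
    then have "e \<subseteq> {..<n}" "card e = 2" using E Suc.prems(1) unfolding simple_graph_def by auto
    then obtain x y where xy: "e = {x, y}" "x < n" "y < n" by (auto simp: card_2_iff)
    have "card (F - {e}) \<le> m" using Suc.prems e by simp
    then obtain B where B: "B \<in> pair_sets n m" "E - B = E - (F - {e})"
      using Suc.IH[of "F - {e}"] Suc.prems by auto
    then have "E - insert {x, y} B = E - F" using e xy(1) by auto
    moreover have "insert {x, y} B \<in> pair_sets n (Suc m)"
      unfolding pair_sets.simps using B(1) xy(2,3) by blast
    ultimately show ?thesis by blast
  qed
qed simp

lemma ws_bump [simp]: "ws (bump g a b) = {}" and wa_bump [simp]: "wa (bump g a b) = {''X''}"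
  unfolding bump_def by auto

lemma runs_bump:
  assumes "runs (bump g a b) \<sigma> \<sigma>'" "arr \<sigma> ''X'' = (\<lambda>x y. cnt {x, y})"
    and x: "scal \<sigma> a = x" "scal \<sigma> b = y" and g: "aval (g (Cell ''X'' (Var a) (Var b))) \<sigma> = v"
  shows "\<sigma>' = set_cell ''X'' y x v (set_cell ''X'' x y v \<sigma>) \<and>
    arr \<sigma>' ''X'' = (\<lambda>x' y'. (cnt({x, y} := v)) {x', y'})"
  using assms unfolding bump_def runs_Seq by (auto simp: fun_eq_iff doubleton_eq_iff)

text \<open>\<open>cnt\<close> describes the deletions made by the outer levels, which leave a
  budget of \<open>m\<close> for the inner ones. \<open>SI\<close> is indexed by the collection of
  deleted sets treated so far and must tolerate changes of the counters and of \<open>X\<close>.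
  Restoring \<open>X\<close> lets each enclosing loop continue.\<close>

lemma nest_correct:
  fixes SI :: "nat set set set \<Rightarrow> state \<Rightarrow> bool"
  assumes scal_inv: "\<And>D \<sigma> j k. SI D \<sigma> \<Longrightarrow> SI D (set_scal (zv j) k \<sigma>)"
    and cell_inv: "\<And>D \<sigma> a b k. SI D \<sigma> \<Longrightarrow> SI D (set_cell ''X'' a b k \<sigma>)"
    and n: "\<And>D \<sigma>. SI D \<sigma> \<Longrightarrow> scal \<sigma> ''n'' = n"
    and c: "\<And>D \<sigma> \<sigma>' cnt. SI D \<sigma> \<Longrightarrow> arr \<sigma> ''X'' = (\<lambda>x y. cnt {x, y}) \<Longrightarrow> finite {e. cnt e \<noteq> 0} \<Longrightarrow>
      card {e. cnt e \<noteq> 0} \<le> M \<Longrightarrow> runs c \<sigma> \<sigma>' \<Longrightarrow> SI (insert {e. cnt e \<noteq> 0} D) \<sigma>'"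
    and fr: "''X'' \<notin> wa c" "\<And>j. zv j \<notin> ws c" "''n'' \<notin> ws c"
  shows "SI D \<sigma> \<Longrightarrow> arr \<sigma> ''X'' = (\<lambda>x y. cnt {x, y}) \<Longrightarrow> finite {e. cnt e \<noteq> 0} \<Longrightarrow>
    card {e. cnt e \<noteq> 0} + m \<le> M \<Longrightarrow> runs (nest m c) \<sigma> \<sigma>' \<Longrightarrow>
    SI (D \<union> (\<lambda>F. {e. cnt e \<noteq> 0} \<union> F) ` pair_sets n m) \<sigma>' \<and> arr \<sigma>' ''X'' = (\<lambda>x y. cnt {x, y})"
proof (induction m arbitrary: D \<sigma> \<sigma>' cnt)
  case 0
  then show ?case using c[of D \<sigma> cnt \<sigma>'] agree_arr[OF runs_agree fr(1)] by simp
next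
  case (Suc m)
  let ?a = "zv (2 * m)" and ?b = "zv (2 * m + 1)" and ?C = "{e. cnt e \<noteq> 0}"
  let ?body = "Seq (bump (\<lambda>a. Plus a (Num 1)) ?a ?b) (Seq (nest m c) (bump (\<lambda>a. Minus a (Num 1)) ?a ?b))"
  let ?in = "For ?b (Var ''n'') ?body"
  let ?X = "\<lambda>x y. cnt {x, y}"
  let ?U = "\<lambda>x. (\<lambda>F. ?C \<union> F) ` (\<Union>x'<x. \<Union>y<n. insert {x', y} ` pair_sets n m)"
  have frame: "zv j \<notin> ws (nest m c)" if "2 * m \<le> j" for j using that fr(2)[of j] by auto
  have ws: "ws ?body = ws (nest m c)" by simp
  have n_ws: "''n'' \<notin> ws (nest m c)" using fr(3) by auto
  have run: "runs (For ?a (Var ''n'') ?in) \<sigma> \<sigma>'" using Suc.prems(5) by simp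
  have "SI (D \<union> ?U n) \<sigma>' \<and> arr \<sigma>' ''X'' = ?X"
  proof (rule runs_For[OF run, where I = "\<lambda>x \<tau>. SI (D \<union> ?U x) \<tau> \<and> arr \<tau> ''X'' = ?X"])
    fix x \<sigma>1 \<sigma>2
    assume x: "x < n" "SI (D \<union> ?U x) \<sigma>1 \<and> arr \<sigma>1 ''X'' = ?X" "scal \<sigma>1 ?a = x" and r: "runs ?in \<sigma>1 \<sigma>2"
    let ?V = "\<lambda>y. (\<lambda>F. ?C \<union> F) ` (\<Union>y'<y. insert {x, y'} ` pair_sets n m)"
    have "SI (D \<union> ?U x \<union> ?V n) \<sigma>2 \<and> arr \<sigma>2 ''X'' = ?X"
    proof (rule runs_For[OF r, where I = "\<lambda>y \<tau>. SI (D \<union> ?U x \<union> ?V y) \<tau> \<and> arr \<tau> ''X'' = ?X"])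
      fix y \<tau>1 \<tau>2
      assume y: "y < n" "SI (D \<union> ?U x \<union> ?V y) \<tau>1 \<and> arr \<tau>1 ''X'' = ?X" "scal \<tau>1 ?b = y"
        and ag: "agree ?in \<sigma>1 \<tau>1" and r: "runs ?body \<tau>1 \<tau>2"
      have a: "scal \<tau>1 ?a = x" using agree_scal[OF ag, of ?a] frame[of "2 * m"] x(3) ws by simp
      obtain \<tau>3 \<tau>4 where r3: "runs (bump (\<lambda>a. Plus a (Num 1)) ?a ?b) \<tau>1 \<tau>3" and r4: "runs (nest m c) \<tau>3 \<tau>4"
        and r5: "runs (bump (\<lambda>a. Minus a (Num 1)) ?a ?b) \<tau>4 \<tau>2"
        using r unfolding runs_Seq by blast
      define cnt' where "cnt' = cnt({x, y} := Suc (cnt {x, y}))"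
      have C': "{e. cnt' e \<noteq> 0} = insert {x, y} ?C" unfolding cnt'_def by auto
      have \<tau>3: "\<tau>3 = set_cell ''X'' y x (Suc (cnt {x, y})) (set_cell ''X'' x y (Suc (cnt {x, y})) \<tau>1)"
        "arr \<tau>3 ''X'' = (\<lambda>x y. cnt' {x, y})"
        using runs_bump[OF r3 _ a y(3), of cnt "Suc (cnt {x, y})"] y a unfolding cnt'_def by auto
      have "SI (D \<union> ?U x \<union> ?V y) \<tau>3" unfolding \<tau>3(1) using y(2) cell_inv by blast
      moreover have "card {e. cnt' e \<noteq> 0} + m \<le> M"
        using Suc.prems(3,4) unfolding C' by (simp add: card_insert_if)
      ultimately have 4: "SI (D \<union> ?U x \<union> ?V y \<union> (\<lambda>F. {e. cnt' e \<noteq> 0} \<union> F) ` pair_sets n m) \<tau>4"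
        "arr \<tau>4 ''X'' = (\<lambda>x y. cnt' {x, y})"
        using Suc.IH[OF _ \<tau>3(2) _ _ r4] Suc.prems(3) C' by auto
      have sc4: "scal \<tau>4 ?a = x" "scal \<tau>4 ?b = y"
        using agree_scal[OF runs_agree[OF r4]] frame[of "2 * m"] frame[of "2 * m + 1"] a y(3)
        unfolding \<tau>3(1) by auto
      \<comment> \<open>Here counts matter instead of flags: a pair also deleted at an outer level
        must remain deleted after this decrement.\<close>
      have eq: "cnt'({x, y} := cnt {x, y}) = cnt" unfolding cnt'_def by auto
      have "aval (Minus (Cell ''X'' (Var ?a) (Var ?b)) (Num 1)) \<tau>4 = cnt {x, y}"
        using sc4 4(2) by (simp add: cnt'_def)
      from runs_bump[OF r5 4(2) sc4 this] have \<tau>2: "\<tau>2 = set_cell ''X'' y x (cnt {x, y}) (set_cell ''X'' x y (cnt {x, y}) \<tau>4)" "arr \<tau>2 ''X'' = ?X"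
        unfolding eq by blast+
      have "(\<lambda>F. {e. cnt' e \<noteq> 0} \<union> F) ` pair_sets n m = (\<lambda>F. ?C \<union> F) ` (insert {x, y} ` pair_sets n m)"
        unfolding C' image_image by simp
      then have "D \<union> ?U x \<union> ?V y \<union> (\<lambda>F. {e. cnt' e \<noteq> 0} \<union> F) ` pair_sets n m = D \<union> ?U x \<union> ?V (Suc y)"
        by (simp add: lessThan_Suc image_Un Un_ac)
      then show "SI (D \<union> ?U x \<union> ?V (Suc y)) \<tau>2 \<and> arr \<tau>2 ''X'' = ?X"
        using 4(1) \<tau>2 cell_inv by simp
    qed (use x n ws n_ws frame[of "2 * m + 1"] in \<open>auto intro: scal_inv\<close>)
    moreover have "D \<union> ?U x \<union> ?V n = D \<union> ?U (Suc x)" by (simp add: lessThan_Suc image_Un Un_ac)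
    ultimately show "SI (D \<union> ?U (Suc x)) \<sigma>2 \<and> arr \<sigma>2 ''X'' = ?X" by simp
  qed (use Suc.prems n ws n_ws frame[of "2 * m"] in \<open>auto intro: scal_inv\<close>)
  then show ?case by simp
qed

lemma last_inv_Suc: "last_inv n s E K m h0 d D \<sigma> \<Longrightarrow> last_inv n s E K m h0 (Suc d) D \<sigma>"
  unfolding last_inv_def by (elim conjE exE) (intro conjI exI, assumption+, erule edge_log_Suc)

text \<open>\<open>K\<close> has two roles: distances below it are treated, and \<open>d < K\<close>
  bounds the paths stored in the log by \<open>K\<close> edges.\<close>

lemma phase_correct:
  assumes E: "simple_graph {..<n} E" and s: "s < n" and inv: "last_inv n s E K m h0 0 {} \<sigma>"
    and b: "scal \<sigma> b = K" "b \<in> {''n'', ''b''}" "K \<le> n"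
    and X: "arr \<sigma> ''X'' = (\<lambda>_ _. 0)" and run: "runs (phase m b) \<sigma> \<sigma>'"
  shows "last_inv n s E K m h0 n ({..<K} \<times> pair_sets n m) \<sigma>' \<and> arr \<sigma>' ''X'' = (\<lambda>_ _. 0)"
proof -
  let ?c = "Cond (Minus (Var b) (Var ''d'')) (nest m add_last_edges) Skip"
  let ?P = "pair_sets n m"
  define I where "I d \<tau> \<longleftrightarrow> last_inv n s E K m h0 d ({..<min d K} \<times> ?P) \<tau> \<and> arr \<tau> ''X'' = (\<lambda>_ _. 0)"
    for d \<tau>
  have bz: "b \<notin> ws (nest m add_last_edges)" using b(2) by auto
  have "I n \<sigma>'"
  proof (rule runs_For[OF run[unfolded phase_def], where I = I])
    fix d \<sigma>1 \<sigma>2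
    assume d: "d < n" "I d \<sigma>1" "scal \<sigma>1 ''d'' = d" and ag: "agree (For ''d'' (Var ''n'') ?c) \<sigma> \<sigma>1"
      and r: "runs ?c \<sigma>1 \<sigma>2"
    have K: "scal \<sigma>1 b = K" using agree_scal[OF ag, of b] bz b by auto
    have "last_inv n s E K m h0 d ({..<min (Suc d) K} \<times> ?P) \<sigma>2 \<and> arr \<sigma>2 ''X'' = (\<lambda>_ _. 0)"
    proof (cases "d < K")
      case False
      then have "\<sigma>2 = \<sigma>1" using r K d(3) unfolding runs_Cond by simp
      then show ?thesis using d(2) False unfolding I_def by (simp add: min_def split: if_splits)
    next
      case True
      then have rn: "runs (nest m add_last_edges) \<sigma>1 \<sigma>2" using r K d(3) unfolding runs_Cond by simp
      define SI where "SI D \<tau> \<longleftrightarrow> last_inv n s E K m h0 d ({..<d} \<times> ?P \<union> {d} \<times> D) \<tau> \<and> scal \<tau> ''d'' = d" for D \<tau>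
      have "SI ({} \<union> (\<lambda>F. {e. 0 \<noteq> (0::nat)} \<union> F) ` ?P) \<sigma>2 \<and> arr \<sigma>2 ''X'' = (\<lambda>_ _. 0)"
      proof (rule nest_correct[where SI = SI and cnt = "\<lambda>_. 0" and M = m and c = add_last_edges])
        fix D \<tau> \<tau>' cnt
        assume t: "SI D \<tau>" "arr \<tau> ''X'' = (\<lambda>x y. cnt {x, y})" "finite {e. cnt e \<noteq> (0::nat)}"
          "card {e. cnt e \<noteq> 0} \<le> m" "runs add_last_edges \<tau> \<tau>'"
        have "scal \<tau>' ''d'' = d" using agree_scal[OF runs_agree[OF t(5)], of "''d''"] t(1) unfolding SI_def by simp
        moreover have "last_inv n s E K m h0 d (insert (d, {e. cnt e \<noteq> 0}) ({..<d} \<times> ?P \<union> {d} \<times> D)) \<tau>'"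
          using add_last_edges_correct[OF E s _ _ d(1) True t(2) refl t(3,4,5)] t(1) unfolding SI_def by blast
        moreover have "insert (d, {e. cnt e \<noteq> 0}) ({..<d} \<times> ?P \<union> {d} \<times> D) =
          {..<d} \<times> ?P \<union> {d} \<times> insert {e. cnt e \<noteq> 0} D" by auto
        ultimately show "SI (insert {e. cnt e \<noteq> 0} D) \<tau>'" unfolding SI_def by simp
      qed (use rn d True in \<open>auto simp: SI_def I_def last_inv_def\<close>)
      moreover have "{..<d} \<times> ?P \<union> {d} \<times> ?P = {..<min (Suc d) K} \<times> ?P" using True by auto
      ultimately show ?thesis unfolding SI_def by simp
    qed
    then show "I (Suc d) \<sigma>2" unfolding I_def using last_inv_Suc by blast
  qed (use inv X in \<open>auto simp: I_def last_inv_def\<close>)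
  then show ?thesis using b(3) unfolding I_def by (simp add: min_absorb2)
qed

section \<open>Values of the stretch parameters\<close>

lemma log_stretch_correct:
  assumes run: "runs log_stretch \<sigma> \<sigma>'" and n: "scal \<sigma> ''n'' = n"
  shows "\<exists>\<kappa>\<ge>1. scal \<sigma>' ''t'' = 2 * \<kappa> - 1 \<and> n \<le> 4 ^ \<kappa> \<and> (\<kappa> = 1 \<or> 4 ^ (\<kappa> - 1) < n)"
proof -
  let ?c = "Cond (Minus (Var ''n'') (Var ''p''))
       (Seq (Assign ''p'' (times 4 (Var ''p''))) (Assign ''t'' (Plus (Var ''t'') (Num 2)))) Skip"
  define I where "I i \<tau> \<longleftrightarrow> scal \<tau> ''n'' = n \<and> (\<exists>\<kappa>\<ge>1. scal \<tau> ''p'' = 4 ^ \<kappa> \<and> scal \<tau> ''t'' = 2 * \<kappa> - 1 \<and>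
    (\<kappa> = 1 \<or> 4 ^ (\<kappa> - 1) < n) \<and> (n \<le> 4 ^ \<kappa> \<or> i < \<kappa>))" for i and \<tau> :: state
  let ?\<sigma> = "set_scal ''p'' 4 (set_scal ''t'' 1 \<sigma>)"
  have r: "runs (For ''l'' (Var ''n'') ?c) ?\<sigma> \<sigma>'"
    using run unfolding log_stretch_def runs_Seq by simp
  have "I n \<sigma>'"
  proof (rule runs_For[OF r, where I = I])
    show "I 0 ?\<sigma>" using n unfolding I_def by (auto intro!: exI[of _ 1])
  next
    fix i \<tau>1 \<tau>2
    assume "I i \<tau>1" and r: "runs ?c \<tau>1 \<tau>2"
    then obtain \<kappa> where \<kappa>: "scal \<tau>1 ''n'' = n" "\<kappa> \<ge> 1" "scal \<tau>1 ''p'' = 4 ^ \<kappa>" "scal \<tau>1 ''t'' = 2 * \<kappa> - 1"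
      "\<kappa> = 1 \<or> 4 ^ (\<kappa> - 1) < n" "n \<le> 4 ^ \<kappa> \<or> i < \<kappa>" unfolding I_def by (elim exE conjE)
    show "I (Suc i) \<tau>2"
    proof (cases "n \<le> 4 ^ \<kappa>")
      case True
      then have "\<tau>2 = \<tau>1" using r \<kappa> unfolding runs_Cond by simp
      then show ?thesis using \<kappa> True unfolding I_def by (auto intro!: exI[of _ \<kappa>])
    next
      case False
      then have "\<tau>2 = set_scal ''t'' (2 * \<kappa> - 1 + 2) (set_scal ''p'' (4 * 4 ^ \<kappa>) \<tau>1)"
        using r \<kappa> unfolding runs_Cond runs_Seq by simp
      then show ?thesis using \<kappa> False unfolding I_def by (auto intro!: exI[of _ "Suc \<kappa>"])
    qed
  qed (use n in \<open>auto simp: I_def\<close>)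
  then obtain \<kappa> where \<kappa>: "\<kappa> \<ge> 1" "scal \<sigma>' ''t'' = 2 * \<kappa> - 1" "\<kappa> = 1 \<or> 4 ^ (\<kappa> - 1) < n" "n \<le> 4 ^ \<kappa> \<or> n < \<kappa>"
    unfolding I_def by (elim exE conjE)
  \<comment> \<open>Every round that finds \<open>p\<close> too small raises \<kappa>, so otherwise
    \<open>n < \<kappa>\<close> after \<open>n\<close> rounds; this too gives
    \<open>n \<le> 4 ^ \<kappa>\<close>.\<close>
  moreover have "(2::nat) ^ \<kappa> \<le> 4 ^ \<kappa>" by (rule power_mono) auto
  then have "\<kappa> < 4 ^ \<kappa>" using less_exp[of \<kappa>] by linarith
  ultimately show ?thesis by (intro exI[of _ \<kappa>]) auto
qed

lemma params_correct:
  assumes run: "runs (params f) (input n E s k) \<sigma>"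
  obtains \<kappa> where "\<kappa> \<ge> 1" "scal \<sigma> ''t'' = min n (2 * \<kappa> - 1)" "k \<noteq> 0 \<Longrightarrow> \<kappa> = 2 * k"
    "k = 0 \<Longrightarrow> n \<le> 4 ^ \<kappa> \<and> (\<kappa> = 1 \<or> 4 ^ (\<kappa> - 1) < n)"
    "scal \<sigma> ''b'' = min n (Suc f * (2 * k - 1))" "scal \<sigma> ''n'' = n" "scal \<sigma> ''s'' = s"
    "arr \<sigma> = arr (input n E s k)"
proof -
  let ?\<sigma> = "set_scal ''b'' (n - (n - Suc f * (2 * k - 1))) (set_scal ''t'' (4 * k - 1) (input n E s k))"
  have sc: "scal ?\<sigma> ''n'' = n" "scal ?\<sigma> ''k'' = k" "scal ?\<sigma> ''s'' = s"
    unfolding input_def by auto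
  obtain \<sigma>1 where r: "runs (Cond (Var ''k'') Skip log_stretch) ?\<sigma> \<sigma>1"
    and \<sigma>: "\<sigma> = set_scal ''t'' (scal \<sigma>1 ''n'' - (scal \<sigma>1 ''n'' - scal \<sigma>1 ''t'')) \<sigma>1"
    using run unfolding params_def runs_Seq by (auto simp: input_def)
  have ag: "agree (Cond (Var ''k'') Skip log_stretch) ?\<sigma> \<sigma>1" using r by (rule runs_agree)
  have sc1: "scal \<sigma>1 ''n'' = n" "scal \<sigma>1 ''s'' = s" "scal \<sigma>1 ''b'' = min n (Suc f * (2 * k - 1))"
    "arr \<sigma>1 = arr (input n E s k)"
  proof -
    have w: "ws log_stretch = {''t'', ''p'', ''l''}" "wa log_stretch = {}"
      unfolding log_stretch_def by auto
    show "scal \<sigma>1 ''n'' = n" "scal \<sigma>1 ''s'' = s"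
      using agree_scal[OF ag, of "''n''"] agree_scal[OF ag, of "''s''"] sc w by simp_all
    have "scal \<sigma>1 ''b'' = n - (n - Suc f * (2 * k - 1))"
      using agree_scal[OF ag, of "''b''"] w by simp
    then show "scal \<sigma>1 ''b'' = min n (Suc f * (2 * k - 1))" by linarith
    show "arr \<sigma>1 = arr (input n E s k)"
      using agree_arr[OF ag] w by (intro ext) simp
  qed
  have "\<exists>\<kappa>\<ge>1. scal \<sigma>1 ''t'' = 2 * \<kappa> - 1 \<and> (k \<noteq> 0 \<longrightarrow> \<kappa> = 2 * k) \<and>
    (k = 0 \<longrightarrow> n \<le> 4 ^ \<kappa> \<and> (\<kappa> = 1 \<or> 4 ^ (\<kappa> - 1) < n))"
  proof (cases "k = 0")
    case True
    then have "runs log_stretch ?\<sigma> \<sigma>1" using r sc unfolding runs_Cond by simp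
    from log_stretch_correct[OF this sc(1)] show ?thesis using True by auto
  next
    case False
    then have "\<sigma>1 = ?\<sigma>" using r sc unfolding runs_Cond by simp
    then show ?thesis using False by (intro exI[of _ "2 * k"]) auto
  qed
  then obtain \<kappa> where "\<kappa> \<ge> 1" "scal \<sigma>1 ''t'' = 2 * \<kappa> - 1" "k \<noteq> 0 \<longrightarrow> \<kappa> = 2 * k"
    "k = 0 \<longrightarrow> n \<le> 4 ^ \<kappa> \<and> (\<kappa> = 1 \<or> 4 ^ (\<kappa> - 1) < n)" by (elim exE conjE)
  then show thesis using sc1 by (intro that[of \<kappa>]) (auto simp: \<sigma>)
qed

subsection \<open>Stretch and size of the output\<close>

lemma last_edges_UNIV:
  assumes "last_edges E s d V H" "s \<in> V" "\<And>e. e \<in> E \<Longrightarrow> e \<subseteq> V"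
  shows "last_edges E s d UNIV H"
  unfolding last_edges_def
proof (intro ballI impI)
  fix v assume v: "reach E (Suc d) s v \<and> \<not> reach E d s v"
  then have "v \<in> V" using reach_in[OF _ assms(2,3)] by blast
  then show "\<exists>w. reach E d s w \<and> {w, v} \<in> E \<inter> H" using assms(1) v unfolding last_edges_def by blast
qed

lemma last_inv_start:
  "scal \<sigma> ''n'' = n \<Longrightarrow> scal \<sigma> ''s'' = s \<Longrightarrow> arr \<sigma> ''G'' = adj_matrix E \<Longrightarrow> arr \<sigma> ''H'' = adj_matrix h \<Longrightarrow>
    last_inv n s E K m h 0 {} \<sigma>"
  unfolding last_inv_def by (intro conjI exI[of _ h] edge_log_refl) simp_all

text \<open>Truncating the stretch to \<open>n\<close> keeps the girth condition, as walks on
  \<open>n\<close> vertices shorten to length \<open>n\<close>. Then \<open>girth_edge_bound\<close>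
  applies with the \<kappa>-th root of \<open>n\<close> as \<delta>.\<close>

lemma girth_card:
  fixes S :: "nat set set"
  assumes g: "girth_above (min n (2 * \<kappa> - 1)) S" and \<kappa>: "\<kappa> \<ge> 1" and S: "simple_graph {..<n} S"
  shows "real (card S) \<le> real n * real n powr (1 / real \<kappa>)"
proof -
  have V: "e \<subseteq> {..<n} \<and> card e = 2" if "e \<in> S" for e using S that unfolding simple_graph_def by blast
  have "girth_above (2 * \<kappa> - 1) S"
    unfolding girth_above_def
  proof (intro allI impI notI)
    fix x y assume xy: "{x, y} \<in> S" "reach (S - {{x, y}}) (2 * \<kappa> - 1) x y"
    then have "reach (S - {{x, y}}) (card {..<n}) x y"
      using V[OF xy(1)] V by (intro reach_card[OF xy(2)]) auto
    then have "reach (S - {{x, y}}) (min n (2 * \<kappa> - 1)) x y" using xy(2) by (simp add: min_def)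
    then show False using g xy(1) unfolding girth_above_def by blast
  qed
  moreover have "(real n powr (1 / real \<kappa>)) ^ \<kappa> \<ge> real (card {..<n})"
  proof (cases "n = 0")
    case False
    then have "(real n powr (1 / real \<kappa>)) ^ \<kappa> = real n powr (1 / real \<kappa> * real \<kappa>)"
      by (subst powr_realpow[symmetric]) (auto simp: powr_powr)
    then show ?thesis using \<kappa> False by simp
  qed simp
  ultimately have "real (card {e \<in> S. e \<subseteq> {..<n}}) \<le> real n powr (1 / real \<kappa>) * real (card {..<n})"
    using \<kappa> V by (intro girth_edge_bound[where V = "{..<n}"]) auto
  moreover have "{e \<in> S. e \<subseteq> {..<n}} = S" using V by blast
  ultimately show ?thesis by (simp add: mult.commute)
qed

lemma algorithm_correct:
  assumes E: "simple_graph {..<n} E" and s: "s < n" and run: "runs (algorithm f) (input n E s k) \<sigma>'"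
  obtains H \<kappa> where "arr \<sigma>' ''H'' = adj_matrix H" "H \<subseteq> E" "\<kappa> \<ge> 1" "k \<noteq> 0 \<Longrightarrow> \<kappa> = 2 * k"
    "k = 0 \<Longrightarrow> n \<le> 4 ^ \<kappa> \<and> (\<kappa> = 1 \<or> 4 ^ (\<kappa> - 1) < n)"
    "real (card H) \<le> (real f + 1) * (real n * real n powr (1 / real \<kappa>)) + real n +
       real (n * (\<Sum>i\<le>f. (Suc f * (2 * k - 1)) ^ i))"
    "\<And>F d v. F \<subseteq> E \<Longrightarrow> card F \<le> f \<Longrightarrow> reach (E - F) d s v \<Longrightarrow>
       reach (H - F) (2 * (f + 1) * d + f * (2 * \<kappa> - 1)) s v"
    "\<And>F d v. F \<subseteq> E \<Longrightarrow> card F \<le> f \<Longrightarrow> reach (E - F) d s v \<Longrightarrow> d \<le> Suc f * (2 * k - 1) \<Longrightarrow>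
       reach (H - F) d s v"
proof -
  define R where "R = Suc f * (2 * k - 1)"
  define K where "K = min n R"
  obtain \<sigma>1 \<sigma>2 \<sigma>3 where r1: "runs (params f) (input n E s k) \<sigma>1" and r2: "runs (spanners f) \<sigma>1 \<sigma>2"
    and r3: "runs (phase 0 ''n'') \<sigma>2 \<sigma>3" and r4: "runs (phase f ''b'') \<sigma>3 \<sigma>'"
    using run unfolding algorithm_def runs_Seq by blast
  obtain \<kappa> where \<kappa>: "\<kappa> \<ge> 1" "scal \<sigma>1 ''t'' = min n (2 * \<kappa> - 1)" "k \<noteq> 0 \<Longrightarrow> \<kappa> = 2 * k"
    "k = 0 \<Longrightarrow> n \<le> 4 ^ \<kappa> \<and> (\<kappa> = 1 \<or> 4 ^ (\<kappa> - 1) < n)"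
    and sc1: "scal \<sigma>1 ''b'' = K" "scal \<sigma>1 ''n'' = n" "scal \<sigma>1 ''s'' = s" "arr \<sigma>1 = arr (input n E s k)"
    using params_correct[OF r1] unfolding K_def R_def by blast
  define t where "t = min n (2 * \<kappa> - 1)"
  have EV: "e \<subseteq> {..<n}" "card e = 2" if "e \<in> E" for e using E that unfolding simple_graph_def by auto
  have finE: "finite E" using EV by (intro finite_subset[of E "Pow {..<n}"]) auto
  have "girth_above t ({} :: nat set set)" unfolding girth_above_def by simp
  then have "greedy_inv n f E t {} \<sigma>1"
    unfolding greedy_inv_def using sc1 \<kappa>(2)
    by (auto simp: t_def input_def adj_matrix_def fun_eq_iff intro!: exI[of _ "\<lambda>_. 0"])
  then have "greedy_inv n f E t ({..f} \<times> {..<n} \<times> {..<n}) \<sigma>2"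
    using spanners_correct[OF E _ _ r2] unfolding t_def by simp
  then obtain lab where G2: "arr \<sigma>2 ''G'' = adj_matrix E"
    and lab: "arr \<sigma>2 ''H'' = adj_matrix {e. lab e \<noteq> 0}" "\<And>e. lab e \<noteq> 0 \<Longrightarrow> e \<in> E \<and> lab e \<le> Suc f"
      "\<And>i. girth_above t {e. lab e = Suc i}"
      "\<And>i u v. i \<le> f \<Longrightarrow> u < n \<Longrightarrow> v < n \<Longrightarrow> {u, v} \<in> E \<Longrightarrow> lab {u, v} \<noteq> 0 \<or> reach {e. lab e = Suc i} t u v"
    unfolding greedy_inv_def by blast
  define h0 where "h0 = {e. lab e \<noteq> 0}"
  have ag2: "agree (spanners f) \<sigma>1 \<sigma>2" using r2 by (rule runs_agree)
  have sc2: "scal \<sigma>2 ''n'' = n" "scal \<sigma>2 ''s'' = s" "scal \<sigma>2 ''b'' = K" "arr \<sigma>2 ''X'' = (\<lambda>_ _. 0)"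
    using ag2 sc1 unfolding agree_def spanners_def by (auto simp: input_def)
  \<comment> \<open>The tree phase has \<open>K = n\<close> and \<open>m = 0\<close>: it adds at
    most \<open>n\<close> edges.\<close>
  have "last_inv n s E n 0 h0 0 {} \<sigma>2"
    using sc2 G2 lab(1) unfolding h0_def by (intro last_inv_start)
  from phase_correct[OF E s this sc2(1) _ _ sc2(4) r3]
  have inv3: "last_inv n s E n 0 h0 n ({..<n} \<times> {{}}) \<sigma>3" and X3: "arr \<sigma>3 ''X'' = (\<lambda>_ _. 0)" by simp_all
  then obtain h1 where h1: "arr \<sigma>3 ''H'' = adj_matrix h1" "edge_log E s {..<n} n 0 n h0 h1"
    "\<And>d. d < n \<Longrightarrow> last_edges E s d {..<n} h1" and G3: "arr \<sigma>3 ''G'' = adj_matrix E"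
    "scal \<sigma>3 ''n'' = n" "scal \<sigma>3 ''s'' = s"
    unfolding last_inv_def by auto
  have b3: "scal \<sigma>3 ''b'' = K"
    using agree_scal[OF runs_agree[OF r3], of "''b''"] sc2(3) unfolding phase_def by auto
  have "last_inv n s E K f h1 0 {} \<sigma>3"
    using h1(1) G3 by (intro last_inv_start)
  from phase_correct[OF E s this b3 _ _ X3 r4]
  have "last_inv n s E K f h1 n ({..<K} \<times> pair_sets n f) \<sigma>'" unfolding K_def by simp
  then obtain H where H: "arr \<sigma>' ''H'' = adj_matrix H" "edge_log E s {..<n} K f n h1 H"
    "\<And>d B. d < K \<Longrightarrow> B \<in> pair_sets n f \<Longrightarrow> last_edges (E - B) s d {..<n} H"
    unfolding last_inv_def by auto
  have h0E: "h0 \<subseteq> E" using lab(2) unfolding h0_def by blast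
  have sub: "h0 \<subseteq> h1" "h1 \<subseteq> H" "h1 \<subseteq> E" "H \<subseteq> E"
    using edge_log_subset[OF h1(2)] edge_log_subset[OF H(2)] h0E by auto
  have S: "simple_graph {..<n} {e. lab e = Suc i}" for i
    unfolding simple_graph_def using lab(2) EV by auto
  have "h0 = (\<Union>i\<le>f. {e. lab e = Suc i})"
  proof (intro equalityI subsetI)
    fix e assume "e \<in> h0"
    then show "e \<in> (\<Union>i\<le>f. {e. lab e = Suc i})"
      using lab(2)[of e] unfolding h0_def by (cases "lab e") auto
  qed (auto simp: h0_def)
  then have "card h0 \<le> (\<Sum>i\<le>f. card {e. lab e = Suc i})"
    using card_UN_le[of "{..f}" "\<lambda>i. {e. lab e = Suc i}"] by simp
  then have "real (card h0) \<le> (\<Sum>i\<le>f. real (card {e. lab e = Suc i}))"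
    by (metis of_nat_le_iff of_nat_sum)
  also have "\<dots> \<le> (\<Sum>i\<le>f. real n * real n powr (1 / real \<kappa>))"
    using girth_card[OF _ \<kappa>(1) S] lab(3) unfolding t_def by (intro sum_mono) blast
  also have "\<dots> = (real f + 1) * (real n * real n powr (1 / real \<kappa>))" by simp
  finally have c0: "real (card h0) \<le> (real f + 1) * (real n * real n powr (1 / real \<kappa>))" .
  have c1: "finite h1 \<and> card h1 \<le> card h0 + n"
    using edge_log_card[OF h1(2)] finite_subset[OF h0E finE] by simp
  have "card H \<le> card h1 + n * (\<Sum>i\<le>f. K ^ i)"
    using edge_log_card[OF H(2)] c1 by simp
  also have "(\<Sum>i\<le>f. K ^ i) \<le> (\<Sum>i\<le>f. R ^ i)" unfolding K_def by (intro sum_mono power_mono) auto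
  finally have "card H \<le> card h0 + n + n * (\<Sum>i\<le>f. R ^ i)" using c1 by simp
  then have "real (card H) \<le> real (card h0 + n + n * (\<Sum>i\<le>f. R ^ i))" by (rule of_nat_mono)
  then have cH: "real (card H) \<le> (real f + 1) * (real n * real n powr (1 / real \<kappa>)) + real n +
       real (n * (\<Sum>i\<le>f. R ^ i))" using c0 by simp
  have card: "reach (E - F) n s v" if "reach (E - F) d s v" for F d v
    using reach_card[OF that, of "{..<n}"] s EV by auto
  have tree: "last_edges E s d UNIV H" for d
  proof (cases "d < n")
    case True
    then have "last_edges E s d UNIV h1" using last_edges_UNIV[OF h1(3)[OF True]] s EV by blast
    then show ?thesis by (rule last_edges_mono[OF _ sub(2)])
  next
    case False
    \<comment> \<open>Layers beyond \<open>n\<close> are empty.\<close>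
    then have "reach E d s v" if "reach E (Suc d) s v" for v
      using card[of "{}" "Suc d" v] that reach_mono_length[of E n s v d] by simp
    then show ?thesis unfolding last_edges_def by blast
  qed
  show thesis
  proof (rule that[OF H(1) sub(4) \<kappa>(1,3,4) cH[unfolded R_def]])
    fix F d v assume F: "F \<subseteq> E" "card F \<le> f" and r: "reach (E - F) d s v"
    have finF: "finite F" using F(1) finE by (rule finite_subset)
    show "reach (H - F) (2 * (f + 1) * d + f * (2 * \<kappa> - 1)) s v"
    proof (rule reach_tree_spanner[OF tree _ finF F(2) r])
      fix x y assume xy: "{x, y} \<in> E - F"
      show "reach (H - F) (2 * \<kappa> - 1) x y"
      proof (cases "lab {x, y} = 0")
        case True
        \<comment> \<open>An edge without label was refused in every round, so every spanner
          bypasses it.\<close>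
        have "reach {e. lab e = Suc i} (2 * \<kappa> - 1) x y" if "i \<le> f" for i
          using lab(4)[OF that, of x y] EV(1)[of "{x, y}"] xy True
            reach_mono_length[of _ t x y "2 * \<kappa> - 1"] unfolding t_def by auto
        then show ?thesis
        proof (rule reach_disjoint_spanners[OF _ _ _ finF F(2)])
          fix i
          have "{e. lab e = Suc i} \<subseteq> h0" unfolding h0_def by auto
          then show "{e. lab e = Suc i} \<subseteq> H" using sub(1,2) by blast
        qed auto
      next
        case False
        then have "{x, y} \<in> H - F" using xy sub(1,2) unfolding h0_def by blast
        then show ?thesis using \<kappa>(1) by (intro reach_edge) auto
      qed
    qed
  next
    fix F d v assume F: "F \<subseteq> E" "card F \<le> f" and r: "reach (E - F) d s v" and d: "d \<le> Suc f * (2 * k - 1)"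
    obtain B where B: "B \<in> pair_sets n f" "E - B = E - F"
      using pair_sets_cover[OF E _ F(1) finite_subset[OF F(1) finE] F(2)] s by auto
    have "last_edges (E - F) s d' UNIV H" if "d' < K" for d'
      using last_edges_UNIV[OF H(3)[OF that B(1)]] s EV unfolding B(2) by blast
    then have ex: "reach (H - F) d' s v" if "reach (E - F) d' s v" "d' \<le> K" for d'
      using reach_last_edges[of K E F s H d' v] that by blast
    show "reach (H - F) d s v"
    proof (cases "d \<le> n")
      case True
      then show ?thesis using ex[OF r] d unfolding K_def R_def by simp
    next
      case False
      \<comment> \<open>Here the walk exceeds \<open>n\<close> and \<open>K\<close> is
        \<open>n\<close>; it is first shortened to \<open>n\<close> edges.\<close>
      then have "n \<le> K" using d unfolding K_def R_def by simp
      then have "reach (H - F) n s v" using ex[OF card[OF r]] by simp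
      then show ?thesis using False by (auto intro: reach_mono_length)
    qed
  qed
qed

section \<open>From walk lengths to the two structures\<close>

lemma ft_abfsI:
  assumes E: "\<And>e. e \<in> E \<Longrightarrow> e \<subseteq> V" and s: "s \<in> V" and H: "H \<subseteq> E" and \<alpha>: "\<alpha> > 0"
    and st: "\<And>F d v. F \<subseteq> E \<Longrightarrow> card F \<le> f \<Longrightarrow> reach (E - F) d s v \<Longrightarrow>
      \<exists>l. reach (H - F) l s v \<and> real l \<le> \<alpha> * real d + \<beta>"
  shows "ft_abfs f \<alpha> \<beta> V E s H"
  unfolding ft_abfs_def
proof (intro conjI ballI allI impI H)
  fix v F assume F: "F \<subseteq> E \<and> card F \<le> f"
  show "ereal_of_enat (gdist V (H - F) s v) \<le> ereal \<alpha> * ereal_of_enat (gdist V (E - F) s v) + ereal \<beta>"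
  proof (cases "gdist V (E - F) s v")
    case infinity
    \<comment> \<open>As \<alpha> is positive, the right-hand side is infinite too.\<close>
    then show ?thesis using \<alpha> by simp
  next
    case (enat d)
    then have "reach (E - F) d s v" using gdist_le_iff[OF s, of "E - F" v d] E by auto
    then obtain l where l: "reach (H - F) l s v" "real l \<le> \<alpha> * real d + \<beta>" using st F by blast
    then have "gdist V (H - F) s v \<le> enat l" using gdist_le_iff[OF s, of "H - F" v l] E H by auto
    then have "ereal_of_enat (gdist V (H - F) s v) \<le> ereal_of_enat (enat l)"
      by (simp only: ereal_of_enat_le_iff)
    also have "\<dots> \<le> ereal (\<alpha> * real d + \<beta>)" using l(2) by simp
    finally show ?thesis unfolding enat by simp
  qed
qed

lemma sum_power_le: "2 \<le> K \<Longrightarrow> (\<Sum>i\<le>m. K ^ i) \<le> (K::nat) ^ Suc m"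
proof (induction m)
  case (Suc m)
  then have "(\<Sum>i\<le>Suc m. K ^ i) \<le> 2 * K ^ Suc m" by simp
  also have "\<dots> \<le> K * K ^ Suc m" using Suc.prems by (rule mult_right_mono) simp
  finally show ?case by simp
qed simp

theorem theorem2:
  "\<exists>C::real. \<forall>f::nat. f \<ge> 1 \<longrightarrow>
    (\<exists>(A::com) (q::nat poly). \<forall>(n::nat) (E::nat set set) (s::nat).
      simple_graph {..<n} E \<and> s \<in> {..<n} \<longrightarrow>
        (\<exists>H. constructs_within A (input n E s 0) (poly q n) H \<and>
             ft_abfs f (3 * (real f + 1)) ((real f + 1) * log 2 (real n)) {..<n} E s H \<and>
             real (card H) \<le> C * (real f * real n)) \<and>
        (\<forall>k::nat. k \<ge> 3 \<longrightarrow>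
          (\<exists>H. constructs_within A (input n E s k) (poly q n) H \<and>
               ft_abfs f (3 * (real f + 1) + 1) 0 {..<n} E s H \<and>
               real (card H) \<le> C * (real f * real n + real n powr (1 + 1 / real k)
                   + real n * ((real f + 1) * (2 * real k - 1)) ^ (f + 1)))))"
proof (intro exI[of _ 10] allI impI)
  fix f :: nat assume f: "f \<ge> 1"
  obtain q where q: "\<And>\<sigma>. \<exists>t \<sigma>'. exec (algorithm f) \<sigma> t \<sigma>' \<and> t \<le> poly q (scal \<sigma> ''n'')"
    using polytime_algorithm unfolding polytime_def by blast
  have main: "(\<exists>H. constructs_within (algorithm f) (input n E s 0) (poly q n) H \<and>
             ft_abfs f (3 * (real f + 1)) ((real f + 1) * log 2 (real n)) {..<n} E s H \<and>
             real (card H) \<le> 10 * (real f * real n)) \<and>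
        (\<forall>k::nat. k \<ge> 3 \<longrightarrow>
          (\<exists>H. constructs_within (algorithm f) (input n E s k) (poly q n) H \<and>
               ft_abfs f (3 * (real f + 1) + 1) 0 {..<n} E s H \<and>
               real (card H) \<le> 10 * (real f * real n + real n powr (1 + 1 / real k)
                   + real n * ((real f + 1) * (2 * real k - 1)) ^ (f + 1))))"
    if "simple_graph {..<n} E \<and> s \<in> {..<n}" for n s :: nat and E
  proof -
    have E: "simple_graph {..<n} E" and s: "s < n" using that by auto
    have EV: "e \<subseteq> {..<n}" if "e \<in> E" for e using E that unfolding simple_graph_def by blast
    have run: "\<exists>t \<sigma>'. exec (algorithm f) (input n E s k) t \<sigma>' \<and> t \<le> poly q n" for k
      using q[of "input n E s k"] by (simp add: input_def)
    have n1: "real n \<ge> 1" using s by simp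
    show ?thesis
    proof (intro conjI allI impI)
      obtain t \<sigma>' where t: "exec (algorithm f) (input n E s 0) t \<sigma>'" "t \<le> poly q n" using run by blast
      then have "runs (algorithm f) (input n E s 0) \<sigma>'" unfolding runs_def by blast
      then obtain H \<kappa> where H: "arr \<sigma>' ''H'' = adj_matrix H" "H \<subseteq> E" "\<kappa> \<ge> 1"
        and \<kappa>: "n \<le> 4 ^ \<kappa>" "\<kappa> = 1 \<or> 4 ^ (\<kappa> - 1) < n"
        and c: "real (card H) \<le> (real f + 1) * (real n * real n powr (1 / real \<kappa>)) + real n +
          real (n * (\<Sum>i\<le>f. (Suc f * (2 * 0 - 1)) ^ i))"
        and st: "\<And>F d v. F \<subseteq> E \<Longrightarrow> card F \<le> f \<Longrightarrow> reach (E - F) d s v \<Longrightarrow>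
          reach (H - F) (2 * (f + 1) * d + f * (2 * \<kappa> - 1)) s v"
        by (rule algorithm_correct[OF E s]) blast
      \<comment> \<open>By minimality of \<kappa>, \<open>4 ^ (\<kappa> - 1) < n\<close>, so
        \<open>2 * (\<kappa> - 1)\<close> is at most the logarithm of \<open>n\<close>; for
        \<open>\<kappa> = 1\<close> the left-hand side is 1.\<close>
      have lg: "real (2 * \<kappa> - 1) \<le> log 2 (real n) + 1"
      proof (cases "\<kappa> = 1")
        case False
        then have "(4::real) ^ (\<kappa> - 1) < real n" using \<kappa>(2)
          by (metis of_nat_less_iff of_nat_numeral of_nat_power)
        moreover have "(4::real) ^ (\<kappa> - 1) = 2 powr real (2 * (\<kappa> - 1))"
          by (subst powr_realpow) (auto simp: power_mult)
        ultimately have "2 powr real (2 * (\<kappa> - 1)) \<le> real n" by linarith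
        then have "real (2 * (\<kappa> - 1)) \<le> log 2 (real n)" using n1 by (simp add: le_log_iff)
        moreover have "real (2 * \<kappa> - 1) = real (2 * (\<kappa> - 1)) + 1" using H(3) by linarith
        ultimately show ?thesis by linarith
      qed (use n1 in simp)
      have lg0: "log 2 (real n) \<ge> 0" using n1 by simp
      have ft: "ft_abfs f (3 * (real f + 1)) ((real f + 1) * log 2 (real n)) {..<n} E s H"
      proof (rule ft_abfsI[OF EV _ H(2)])
        fix F d v assume F: "F \<subseteq> E" "card F \<le> f" and r: "reach (E - F) d s v"
        show "\<exists>l. reach (H - F) l s v \<and> real l \<le> 3 * (real f + 1) * real d + (real f + 1) * log 2 (real n)"
        \<comment> \<open>The stretch leaves an additive \<open>f\<close> beyond the logarithmic
          term. It is absorbed by \<open>(f + 1) * d\<close>, which requires \<open>d\<close> to be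
          positive; for \<open>d = 0\<close> the target is \<open>s\<close>.\<close>
        proof (cases "d = 0")
          case True
          then show ?thesis using r lg0 by (intro exI[of _ 0]) auto
        next
          case False
          have "real f * real (2 * \<kappa> - 1) \<le> real f * (log 2 (real n) + 1)"
            using lg by (rule mult_left_mono) simp
          also have "\<dots> \<le> (real f + 1) * log 2 (real n) + (real f + 1) * real d"
          proof -
            have "real f * 1 \<le> (real f + 1) * real d" using False by (intro mult_mono) auto
            then show ?thesis using lg0 by (simp add: algebra_simps)
          qed
          finally have "real (2 * (f + 1) * d + f * (2 * \<kappa> - 1)) \<le>
            3 * (real f + 1) * real d + (real f + 1) * log 2 (real n)"
            by (simp only: of_nat_add of_nat_mult) (simp add: algebra_simps)
          then show ?thesis using st[OF F r] by blast
        qed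
      qed (use s in auto)
      have "real n \<le> 4 ^ \<kappa>" using \<kappa>(1) by (metis of_nat_le_iff of_nat_numeral of_nat_power)
      then have "real n powr (1 / real \<kappa>) \<le> (4 ^ \<kappa>) powr (1 / real \<kappa>)" by (intro powr_mono2) auto
      also have "(4 ^ \<kappa>) powr (1 / real \<kappa>) = (4::real)"
        using H(3) by (subst powr_realpow[symmetric]) (auto simp: powr_powr)
      finally have le: "real n * real n powr (1 / real \<kappa>) \<le> real n * 4" by (rule mult_left_mono) simp
      have "real f + 1 \<le> 2 * real f" using f by simp
      then have "(real f + 1) * (real n * real n powr (1 / real \<kappa>)) \<le> (2 * real f) * (real n * 4)"
        by (rule mult_mono[OF _ le]) simp_all
      \<comment> \<open>With \<open>k = 0\<close>, truncated subtraction makes the base 0, so only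
        the term \<open>0 ^ 0 = 1\<close> remains.\<close>
      moreover have "(\<Sum>i\<le>f. (Suc f * (2 * 0 - 1)) ^ i) = 1"
        by (simp add: power_0_left sum.delta)
      moreover have "real n \<le> real f * real n" using f n1 by (simp add: mult_le_cancel_right1)
      \<comment> \<open>The constant 10: \<open>8 f n\<close> for the spanners, \<open>n\<close> for
        the tree and \<open>n\<close> for the remaining term.\<close>
      ultimately have "real (card H) \<le> 10 * (real f * real n)" using c by simp
      then show "\<exists>H. constructs_within (algorithm f) (input n E s 0) (poly q n) H \<and>
             ft_abfs f (3 * (real f + 1)) ((real f + 1) * log 2 (real n)) {..<n} E s H \<and>
             real (card H) \<le> 10 * (real f * real n)"
        using t H(1) ft unfolding constructs_within_def by blast
    next
      fix k :: nat assume k: "k \<ge> 3"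
      define R where "R = Suc f * (2 * k - 1)"
      have "real (2 * k - 1) = 2 * real k - 1" using k by (simp add: of_nat_diff)
      then have R: "real R = (real f + 1) * (2 * real k - 1)" unfolding R_def of_nat_mult by simp
      obtain t \<sigma>' where t: "exec (algorithm f) (input n E s k) t \<sigma>'" "t \<le> poly q n" using run by blast
      then have "runs (algorithm f) (input n E s k) \<sigma>'" unfolding runs_def by blast
      then obtain H \<kappa> where H: "arr \<sigma>' ''H'' = adj_matrix H" "H \<subseteq> E" "k \<noteq> 0 \<Longrightarrow> \<kappa> = 2 * k"
        and c: "real (card H) \<le> (real f + 1) * (real n * real n powr (1 / real \<kappa>)) + real n +
          real (n * (\<Sum>i\<le>f. R ^ i))"
        and st: "\<And>F d v. F \<subseteq> E \<Longrightarrow> card F \<le> f \<Longrightarrow> reach (E - F) d s v \<Longrightarrow>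
          reach (H - F) (2 * (f + 1) * d + f * (2 * \<kappa> - 1)) s v"
        and ex: "\<And>F d v. F \<subseteq> E \<Longrightarrow> card F \<le> f \<Longrightarrow> reach (E - F) d s v \<Longrightarrow> d \<le> R \<Longrightarrow> reach (H - F) d s v"
        unfolding R_def by (rule algorithm_correct[OF E s]) blast
      have \<kappa>: "\<kappa> = 2 * k" using H(3) k by simp
      have ft: "ft_abfs f (3 * (real f + 1) + 1) 0 {..<n} E s H"
      proof (rule ft_abfsI[OF EV _ H(2)])
        fix F d v assume F: "F \<subseteq> E" "card F \<le> f" and r: "reach (E - F) d s v"
        show "\<exists>l. reach (H - F) l s v \<and> real l \<le> (3 * (real f + 1) + 1) * real d + 0"
        proof (cases "d \<le> R")
          case True
          have "1 * real d \<le> (3 * (real f + 1) + 1) * real d" by (intro mult_right_mono) auto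
          then show ?thesis using ex[OF F r True] by (intro exI[of _ d]) simp
        next
          case False
          \<comment> \<open>As \<open>f + 1\<close> is at least 2, \<open>d > R\<close> gives
            \<open>d\<close> at least \<open>4 k - 1\<close>, which is exactly the spanner stretch
            \<open>2 * \<kappa> - 1\<close>.\<close>
          have "2 * (2 * k - 1) \<le> R" unfolding R_def using f by (intro mult_right_mono) auto
          then have "2 * \<kappa> - 1 \<le> d" using False k unfolding \<kappa> by linarith
          then have "f * (2 * \<kappa> - 1) \<le> f * d" by simp
          then have "2 * (f + 1) * d + f * (2 * \<kappa> - 1) \<le> (3 * (f + 1) + 1) * d"
            by (simp add: algebra_simps)
          then have "real (2 * (f + 1) * d + f * (2 * \<kappa> - 1)) \<le> real ((3 * (f + 1) + 1) * d)"
            by (rule of_nat_mono)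
          also have "real ((3 * (f + 1) + 1) * d) = (3 * (real f + 1) + 1) * real d + 0"
            by (simp add: algebra_simps)
          finally show ?thesis using st[OF F r] by blast
        qed
      qed (use s in auto)
      \<comment> \<open>\<open>y\<close> is the edge density of one spanner; its square is the
        density allowed by the claimed bound.\<close>
      define y where "y = real n powr (1 / real (2 * k))"
      have y2: "y\<^sup>2 = real n powr (1 / real k)"
        unfolding y_def power2_eq_square by (simp add: powr_add[symmetric])
      have R2: "2 \<le> R" unfolding R_def using f k by (intro order_trans[OF _ mult_mono[of 2 "Suc f" 1 "2 * k - 1"]]) auto
      \<comment> \<open>\<open>R\<close> is at least \<open>f + 1\<close>, and since
        \<open>f\<close> is positive the exponent \<open>f + 1\<close> is at least 2.\<close>
      have "(real f + 1)\<^sup>2 \<le> (real R)\<^sup>2"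
      proof (rule power_mono)
        have "(real f + 1) * 1 \<le> real R" unfolding R using k by (intro mult_left_mono) auto
        then show "real f + 1 \<le> real R" by simp
      qed simp
      also have "\<dots> \<le> real R ^ (f + 1)" using R2 f by (intro power_increasing) auto
      finally have f2: "(real f + 1)\<^sup>2 \<le> real R ^ (f + 1)" .
      \<comment> \<open>AM-GM absorbs the factor \<open>f + 1\<close>, because the spanners have exponent \<open>1 / (2 k)\<close> only.\<close>
      define a where "a = real f + 1"
      have "2 * a * y \<le> a\<^sup>2 + y\<^sup>2" by (rule sum_squares_bound)
      moreover have "0 \<le> a\<^sup>2" "0 \<le> y\<^sup>2" by simp_all
      ultimately have "a * y \<le> real R ^ (f + 1) + y\<^sup>2" using f2[folded a_def] by linarith
      then have "(real f + 1) * y \<le> real R ^ (f + 1) + real n powr (1 / real k)" unfolding a_def y2 .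
      then have "real n * ((real f + 1) * y) \<le> real n * (real R ^ (f + 1) + real n powr (1 / real k))"
        by (rule mult_left_mono) simp
      moreover have "real n * real n powr (1 / real k) = real n powr (1 + 1 / real k)"
        using n1 by (simp add: powr_add)
      ultimately have 1: "(real f + 1) * (real n * y) \<le> real n * real R ^ (f + 1) + real n powr (1 + 1 / real k)"
        by (simp add: algebra_simps)
      have "n * (\<Sum>i\<le>f. R ^ i) \<le> n * R ^ (f + 1)" using sum_power_le[OF R2, of f] by simp
      then have "real (n * (\<Sum>i\<le>f. R ^ i)) \<le> real (n * R ^ (f + 1))" by (rule of_nat_mono)
      then have 2: "real (n * (\<Sum>i\<le>f. R ^ i)) \<le> real n * real R ^ (f + 1)" by simp
      have 3: "real n \<le> real f * real n" using f n1 by (simp add: mult_le_cancel_right1)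
      have pos: "0 \<le> real n * real R ^ (f + 1)" "0 \<le> real n powr (1 + 1 / real k)" "0 \<le> real f * real n" by auto
      have "real (card H) \<le> real f * real n + real n powr (1 + 1 / real k) + 2 * (real n * real R ^ (f + 1))"
        using c 1 2 3 unfolding \<kappa> y_def by linarith
      then have "real (card H) \<le> 10 * (real f * real n + real n powr (1 + 1 / real k) + real n * real R ^ (f + 1))"
        using pos by argo
      then show "\<exists>H. constructs_within (algorithm f) (input n E s k) (poly q n) H \<and>
               ft_abfs f (3 * (real f + 1) + 1) 0 {..<n} E s H \<and>
               real (card H) \<le> 10 * (real f * real n + real n powr (1 + 1 / real k)
                   + real n * ((real f + 1) * (2 * real k - 1)) ^ (f + 1))"
        using t H(1) ft unfolding constructs_within_def R by blast
    qed
  qed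
  then show "\<exists>(A::com) (q::nat poly). \<forall>(n::nat) (E::nat set set) (s::nat).
      simple_graph {..<n} E \<and> s \<in> {..<n} \<longrightarrow>
        (\<exists>H. constructs_within A (input n E s 0) (poly q n) H \<and>
             ft_abfs f (3 * (real f + 1)) ((real f + 1) * log 2 (real n)) {..<n} E s H \<and>
             real (card H) \<le> 10 * (real f * real n)) \<and>
        (\<forall>k::nat. k \<ge> 3 \<longrightarrow>
          (\<exists>H. constructs_within A (input n E s k) (poly q n) H \<and>
               ft_abfs f (3 * (real f + 1) + 1) 0 {..<n} E s H \<and>
               real (card H) \<le> 10 * (real f * real n + real n powr (1 + 1 / real k)
                   + real n * ((real f + 1) * (2 * real k - 1)) ^ (f + 1))))"
    by (intro exI[of _ "algorithm f"] exI[of _ q]) blast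
qed

end
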